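(* Assume $q\ge c_q$ for some constant $c_q>0$. Then for any $t\in\mathbb T$, $T_0\in\{t,\dots,T\}$ and $\mu\in\mathcal P_0(\mathbb X_t)$, $$\mathbb V_{relax}(t,\mu)=\bigcap_{\varepsilon>0}\Big\{\varphi\in\mathbb L^0(\mathbb X_t;\mathbb R):\ \|\varphi-J(T_0,\psi;t,\mu,\gamma^*;\cdot,\gamma^* )\|_{\mathbb X_t}\le\varepsilon\ \text{ for some }\psi\in\mathbb L^0(\mathbb X_{T_0}\times\mathcal P_0(\mathbb X_{T_0});\mathbb R)\text{ and }\gamma^*\in\mathcal A_{relax}$$ $$\text{such that }\psi(\cdot,\mu^{\gamma^*}_{T_0\wedge\cdot})\in\mathbb V^\varepsilon_{relax}(T_0,\mu^{\gamma^*}_{T_0\wedge\cdot})\text{ and }\gamma^*\in\mathcal M^\varepsilon_{relax}(T_0,\psi;t,\mu)\Big\}.$$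
   Context: Path dependent setting. $\mathbb T=\{0,\dots,T\}$; $\mathbb S$ finite, $|\mathbb S|=d$; $\mathbb X=\mathbb S^{T+1}$ with elements $\mathbf x=(\mathbf x_0,\dots,\mathbf x_T)$; $\mathbf x_{t\wedge\cdot}:=(\mathbf x_0,\dots,\mathbf x_t,\mathbf x_t,\dots,\mathbf x_t)$; $\mathbb X_t:=\{\mathbf x_{t\wedge\cdot}:\mathbf x\in\mathbb X\}$; $\mathbf x=_t\tilde{\mathbf x}$ means $\mathbf x_{t\wedge\cdot}=\tilde{\mathbf x}_{t\wedge\cdot}$. $\mathcal P(\mathbb X_t)$ is the set of probability measures on $\mathbb X_t$ with $W_1(\mu,\nu):=\sum_{\mathbf x\in\mathbb X_t}|\mu(\mathbf x)-\nu(\mathbf x)|$, $\mathcal P_0(\mathbb X_t)$ those with full support $\mathbb X_t$. $X$ is the canonical process on $\mathbb X$; for $\mu\in\mathcal P(\mathbb X)$, $\mu_{t\wedge\cdot}:=\mu\circ X_{t\wedge\cdot}^{-1}$. A function $\varphi(t,\mathbf x,\mu)$ is adapted if $\varphi(t,\mathbf x,\mu)=\varphi(t,\mathbf x_{t\wedge\cdot},\mu_{t\wedge\cdot})$; all path dependent functions are adapted. $\mathbb L^0(E;\mathbb R)$: measurable functions. $\|\varphi\|_{\mathbb X_t}:=\sup_{\mathbf x\in\mathbb X_t}|\varphi(\mathbf x)|$. Data: $\mathbb A\subset\mathbb R^{d_0}$ measurable; $q:\mathbb T\times\mathbb X\times\mathcal P(\mathbb X)\times\mathbb A\times\mathbb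 S\to(0,1)$ adapted with $\sum_{\tilde x\in\mathbb S}q(t,\mathbf x,\mu,a;\tilde x)=1$; $F:\mathbb T\times\mathbb X\times\mathcal P(\mathbb X)\times\mathbb A\to\mathbb R$ adapted; $G:\mathbb X\times\mathcal P(\mathbb X)\to\mathbb R$. Standing assumption: (i) $q\ge c_q$ for a constant $c_q>0$; (ii) $q$ is Lipschitz continuous in $(\mu,a)$ with constant $L_q$; (iii) $F,G$ are bounded by $C_0$ and uniformly continuous in $(\mu,a)$ with modulus $\rho$. $\mathcal A_{relax}$ is the set of adapted relaxed controls $\gamma:\mathbb T\times\mathbb X\to\mathcal P(\mathbb A)$. Given $t$, $\mu\in\mathcal P(\mathbb X_t)$, $\gamma\in\mathcal A_{relax}$: $\mathbb P^{t,\mu,\gamma}\circ X_{t\wedge\cdot}^{-1}=\mu$, $\mathbb P^{t,\mu,\gamma}(X_{s+1}=\tilde x|X=_s\mathbf x)=\int_{\mathbb A}q(s,\mathbf x,\mu^\gamma,a;\tilde x)\gamma(s,\mathbf x;da)$, with $\mu^\gamma_{s\wedge\cdot}:=\mathbb P^{t,\mu,\gamma}\circ X_{s\wedge\cdot}^{-1}$, $s\ge t$. For $\mathbf x\in\mathbb X_t$, $\tilde\gamma\in\mathcal A_{relax}$: $\mathbb P^{\mu^\gamma;t,\mathbf x,\tilde\gamma}(X=_t\mathbf x)=1$, $\mathbb P^{\mu^\gamma;t,\mathbf x,\tilde\gamma}(X_{s+1}=\bar x|X=_s\tilde{\mathbf x})=\int_{\mathbb A}q(s,\tilde{\mathbf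 x},\mu^\gamma,a;\bar x)\tilde\gamma(s,\tilde{\mathbf x};da)$. Costs: $J(\mu^\gamma;t,\mathbf x,\tilde\gamma):=\mathbb E^{\mathbb P^{\mu^\gamma;t,\mathbf x,\tilde\gamma}}[G(X,\mu^\gamma)+\sum_{r=t}^{T-1}\int_{\mathbb A}F(r,X,\mu^\gamma,a)\tilde\gamma(r,X;da)]$, $J(t,\mu,\gamma;\mathbf x,\tilde\gamma):=J(\mu^\gamma;t,\mathbf x,\tilde\gamma)$, $v(\mu^\gamma;t,\mathbf x):=\inf_{\tilde\gamma\in\mathcal A_{relax}}J(\mu^\gamma;t,\mathbf x,\tilde\gamma)$. For $\mu\in\mathcal P_0(\mathbb X_t)$: $\mathcal M^\varepsilon_{relax}(t,\mu)$ is the set of $\gamma^*\in\mathcal A_{relax}$ with $J(t,\mu,\gamma^*;\mathbf x,\gamma^* )\le v(\mu^{\gamma^*};t,\mathbf x)+\varepsilon$ for all $\mathbf x\in\mathbb X_t$; $\mathbb V^\varepsilon_{relax}(t,\mu):=\{\varphi\in\mathbb L^0(\mathbb X_t;\mathbb R):\exists\gamma^*\in\mathcal M^\varepsilon_{relax}(t,\mu)\text{ s.t. }\|\varphi-J(t,\mu,\gamma^*;\cdot,\gamma^* )\|_{\mathbb X_t}\le\varepsilon\}$; $\mathbb V_{relax}(t,\mu):=\bigcap_{\varepsilon>0}\mathbb V^\varepsilon_{relax}(t,\mu)$. Game on $\{t,\dots,T_0\}$: $J(T_0,\psi;t,\mu,\gamma;\mathbf x,\tilde\gamma):=\mathbb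 E^{\mathbb P^{\mu^\gamma;t,\mathbf x,\tilde\gamma}}[\psi(X_{T_0\wedge\cdot},\mu^\gamma_{T_0\wedge\cdot})+\sum_{s=t}^{T_0-1}\int_{\mathbb A}F(s,X,\mu^\gamma,a)\tilde\gamma(s,X;da)]$, and $\mathcal M^\varepsilon_{relax}(T_0,\psi;t,\mu)$ is the set of $\gamma^*\in\mathcal A_{relax}$ with $J(T_0,\psi;t,\mu,\gamma^*;\mathbf x,\gamma^* )\le\inf_{\gamma\in\mathcal A_{relax}}J(T_0,\psi;t,\mu,\gamma^*;\mathbf x,\gamma)+\varepsilon$ for all $\mathbf x\in\mathbb X_t$. *)

theory Defs
  imports "HOL-Probability.Probability"
begin

text \<open>
  The finite state space is the type \<open>'s\<close>. A path in \<open>'s\<^sup>T\<^sup>+\<^sup>1\<close> is a function that is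
  extensional on \<open>{..T}\<close>. Measures on the finite path spaces are represented as pmfs; a measure
  on stopped paths is at the same time a measure on the full path space.
\<close>

definition paths :: "nat \<Rightarrow> (nat \<Rightarrow> 's) set"
  where "paths T = {..T} \<rightarrow>\<^sub>E UNIV"

definition stop :: "nat \<Rightarrow> nat \<Rightarrow> (nat \<Rightarrow> 's) \<Rightarrow> (nat \<Rightarrow> 's)"
  where "stop T t x = (\<lambda>s\<in>{..T}. x (min s t))"

definition stopped_paths :: "nat \<Rightarrow> nat \<Rightarrow> (nat \<Rightarrow> 's) set"
  where "stopped_paths T t = stop T t ` paths T"

definition stop_law :: "nat \<Rightarrow> nat \<Rightarrow> (nat \<Rightarrow> 's) pmf \<Rightarrow> (nat \<Rightarrow> 's) pmf"
  where "stop_law T t \<mu> = map_pmf (stop T t) \<mu>"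

text \<open>The path that follows \<open>x\<close> up to time \<open>s\<close> and sits in \<open>y\<close> from time \<open>s + 1\<close> on.\<close>

definition append_state :: "nat \<Rightarrow> nat \<Rightarrow> (nat \<Rightarrow> 's) \<Rightarrow> 's \<Rightarrow> (nat \<Rightarrow> 's)"
  where "append_state T s x y = (\<lambda>r\<in>{..T}. if r \<le> s then x r else y)"

definition probs :: "'b set \<Rightarrow> 'b pmf set"
  where "probs E = {\<mu>. set_pmf \<mu> \<subseteq> E}"

definition full_probs :: "'b set \<Rightarrow> 'b pmf set"
  where "full_probs E = {\<mu>. set_pmf \<mu> = E}"

definition W1 :: "'b set \<Rightarrow> 'b pmf \<Rightarrow> 'b pmf \<Rightarrow> real"
  where "W1 E \<mu> \<nu> = (\<Sum>x\<in>E. \<bar>pmf \<mu> x - pmf \<nu> x\<bar>)"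

text \<open>\<open>full_probs E\<close> with the Borel sets of the metric \<open>W1 E\<close>.\<close>

definition full_probs_space :: "'b set \<Rightarrow> 'b pmf measure"
  where "full_probs_space E =
    sigma (full_probs E) {U. openin (Metric_space.mtopology (full_probs E) (W1 E)) U}"

text \<open>Functions on \<open>space M\<close> are made unique by requiring them to be extensional.\<close>

definition L0 :: "'b measure \<Rightarrow> ('b \<Rightarrow> real) set"
  where "L0 M = borel_measurable M \<inter> extensional (space M)"

definition sup_norm :: "'b set \<Rightarrow> ('b \<Rightarrow> real) \<Rightarrow> real"
  where "sup_norm E f = (SUP x\<in>E. \<bar>f x\<bar>)"

definition modulus :: "(real \<Rightarrow> real) \<Rightarrow> bool"
  where "modulus \<rho> \<longleftrightarrow> \<rho> 0 = 0 \<and> mono_on {0..} \<rho> \<and> (\<rho> \<longlongrightarrow> 0) (at_right 0)"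

text \<open>
  Fields: \<open>T\<close>, the action set \<open>A\<close>, \<open>q(t,x,\<mu>,a;y)\<close>, \<open>F(t,x,\<mu>,a)\<close> and \<open>G(x,\<mu>)\<close>.
\<close>

record ('s, 'a) mfg =
  horizon :: nat
  actions :: "'a set"
  transition :: "nat \<Rightarrow> (nat \<Rightarrow> 's) \<Rightarrow> (nat \<Rightarrow> 's) pmf \<Rightarrow> 'a \<Rightarrow> 's \<Rightarrow> real"
  running_cost :: "nat \<Rightarrow> (nat \<Rightarrow> 's) \<Rightarrow> (nat \<Rightarrow> 's) pmf \<Rightarrow> 'a \<Rightarrow> real"
  terminal_cost :: "(nat \<Rightarrow> 's) \<Rightarrow> (nat \<Rightarrow> 's) pmf \<Rightarrow> real"

text \<open>Continuity in \<open>(\<mu>, a)\<close> is with respect to the metric \<open>W1 + norm\<close>.\<close>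

locale mean_field_game =
  fixes D :: "('s::finite, 'a::euclidean_space) mfg"
    and c\<^sub>q L\<^sub>q C\<^sub>0 :: real and \<rho> :: "real \<Rightarrow> real"
  assumes actions_measurable: "actions D \<in> sets borel"
    and transition_range:
      "\<lbrakk>t \<le> horizon D; x \<in> paths (horizon D); \<mu> \<in> probs (paths (horizon D)); a \<in> actions D\<rbrakk>
        \<Longrightarrow> transition D t x \<mu> a y \<in> {0<..<1}"
    and transition_sum:
      "\<lbrakk>t \<le> horizon D; x \<in> paths (horizon D); \<mu> \<in> probs (paths (horizon D)); a \<in> actions D\<rbrakk>
        \<Longrightarrow> (\<Sum>y\<in>UNIV. transition D t x \<mu> a y) = 1"
    and transition_adapted:
      "\<lbrakk>t \<le> horizon D; x \<in> paths (horizon D); \<mu> \<in> probs (paths (horizon D)); a \<in> actions D\<rbrakk>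
        \<Longrightarrow> transition D t x \<mu> a y
          = transition D t (stop (horizon D) t x) (stop_law (horizon D) t \<mu>) a y"
    and running_cost_adapted:
      "\<lbrakk>t \<le> horizon D; x \<in> paths (horizon D); \<mu> \<in> probs (paths (horizon D)); a \<in> actions D\<rbrakk>
        \<Longrightarrow> running_cost D t x \<mu> a
          = running_cost D t (stop (horizon D) t x) (stop_law (horizon D) t \<mu>) a"
    and c\<^sub>q_pos: "0 < c\<^sub>q"
    and transition_lower:
      "\<lbrakk>t \<le> horizon D; x \<in> paths (horizon D); \<mu> \<in> probs (paths (horizon D)); a \<in> actions D\<rbrakk>
        \<Longrightarrow> c\<^sub>q \<le> transition D t x \<mu> a y"
    and transition_lipschitz:
      "\<lbrakk>t \<le> horizon D; x \<in> paths (horizon D);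
        \<mu> \<in> probs (paths (horizon D)); \<mu>' \<in> probs (paths (horizon D));
        a \<in> actions D; a' \<in> actions D\<rbrakk>
        \<Longrightarrow> \<bar>transition D t x \<mu> a y - transition D t x \<mu>' a' y\<bar>
          \<le> L\<^sub>q * (W1 (paths (horizon D)) \<mu> \<mu>' + norm (a - a'))"
    and running_cost_bounded:
      "\<lbrakk>t \<le> horizon D; x \<in> paths (horizon D); \<mu> \<in> probs (paths (horizon D)); a \<in> actions D\<rbrakk>
        \<Longrightarrow> \<bar>running_cost D t x \<mu> a\<bar> \<le> C\<^sub>0"
    and terminal_cost_bounded:
      "\<lbrakk>x \<in> paths (horizon D); \<mu> \<in> probs (paths (horizon D))\<rbrakk>
        \<Longrightarrow> \<bar>terminal_cost D x \<mu>\<bar> \<le> C\<^sub>0"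
    and modulus: "modulus \<rho>"
    and running_cost_continuous:
      "\<lbrakk>t \<le> horizon D; x \<in> paths (horizon D);
        \<mu> \<in> probs (paths (horizon D)); \<mu>' \<in> probs (paths (horizon D));
        a \<in> actions D; a' \<in> actions D\<rbrakk>
        \<Longrightarrow> \<bar>running_cost D t x \<mu> a - running_cost D t x \<mu>' a'\<bar>
          \<le> \<rho> (W1 (paths (horizon D)) \<mu> \<mu>' + norm (a - a'))"
    and terminal_cost_continuous:
      "\<lbrakk>x \<in> paths (horizon D);
        \<mu> \<in> probs (paths (horizon D)); \<mu>' \<in> probs (paths (horizon D))\<rbrakk>
        \<Longrightarrow> \<bar>terminal_cost D x \<mu> - terminal_cost D x \<mu>'\<bar> \<le> \<rho> (W1 (paths (horizon D)) \<mu> \<mu>')"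

type_synonym ('s, 'a) control = "nat \<Rightarrow> (nat \<Rightarrow> 's) \<Rightarrow> 'a measure"

definition relaxed_controls :: "('s, 'a::euclidean_space) mfg \<Rightarrow> ('s, 'a) control set"
  where "relaxed_controls D = {\<gamma>. \<forall>t\<le>horizon D. \<forall>x\<in>paths (horizon D).
    \<gamma> t x \<in> space (prob_algebra (restrict_space borel (actions D))) \<and>
    \<gamma> t x = \<gamma> t (stop (horizon D) t x)}"

text \<open>The law of the next state, \<open>y \<mapsto> \<integral> q(s,x,m,a;y) \<pi>(da)\<close>.\<close>

definition next_state ::
    "('s, 'a) mfg \<Rightarrow> nat \<Rightarrow> (nat \<Rightarrow> 's) \<Rightarrow> (nat \<Rightarrow> 's) pmf \<Rightarrow> 'a measure \<Rightarrow> 's pmf"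
  where "next_state D s x m \<pi> = embed_pmf (\<lambda>y. \<integral>a. transition D s x m a y \<partial>\<pi>)"

text \<open>
  \<open>path_steps T \<kappa> t \<nu> n\<close> is the law at time \<open>t + n\<close> of the stopped path that starts with
  law \<open>\<nu>\<close> at time \<open>t\<close>. The kernel \<open>\<kappa> s P x\<close>, the law of the next state, may depend on the
  law \<open>P\<close> reached at time \<open>s\<close>.
\<close>

primrec path_steps ::
    "nat \<Rightarrow> (nat \<Rightarrow> (nat \<Rightarrow> 's) pmf \<Rightarrow> (nat \<Rightarrow> 's) \<Rightarrow> 's pmf) \<Rightarrow> nat \<Rightarrow> (nat \<Rightarrow> 's) pmf \<Rightarrow> nat
      \<Rightarrow> (nat \<Rightarrow> 's) pmf"
  where
    "path_steps T \<kappa> t \<nu> 0 = \<nu>"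
  | "path_steps T \<kappa> t \<nu> (Suc n) =
      bind_pmf (path_steps T \<kappa> t \<nu> n) (\<lambda>x.
        map_pmf (append_state T (t + n) x) (\<kappa> (t + n) (path_steps T \<kappa> t \<nu> n) x))"

text \<open>
  The measure \<open>\<bbbP>\<^sup>t\<^sup>,\<^sup>\<mu>\<^sup>,\<^sup>\<gamma> = \<mu>\<^sup>\<gamma>\<close> on the full path space. The transition probability at time \<open>s\<close> is
  evaluated at the law of the path stopped at \<open>s\<close>, which by adaptedness is the same as evaluating
  it at the law of the whole path; see \<open>mf_law_initial\<close> and \<open>mf_law_transition\<close> below.
\<close>

definition mf_law ::
    "('s, 'a) mfg \<Rightarrow> nat \<Rightarrow> (nat \<Rightarrow> 's) pmf \<Rightarrow> ('s, 'a) control \<Rightarrow> (nat \<Rightarrow> 's) pmf"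
  where "mf_law D t \<mu> \<gamma> = path_steps (horizon D)
    (\<lambda>s P x. next_state D s x P (\<gamma> s x)) t \<mu> (horizon D - t)"

text \<open>
  The law \<open>\<bbbP>\<^sup>m\<^sup>;\<^sup>t\<^sup>,\<^sup>x\<^sup>,\<^sup>\<gamma>\<close> of a single player's path in the environment \<open>m\<close>; see
  \<open>player_law_initial\<close> and \<open>player_law_transition\<close> below.
\<close>

definition player_law ::
    "('s, 'a) mfg \<Rightarrow> (nat \<Rightarrow> 's) pmf \<Rightarrow> nat \<Rightarrow> (nat \<Rightarrow> 's) \<Rightarrow> ('s, 'a) control
      \<Rightarrow> (nat \<Rightarrow> 's) pmf"
  where "player_law D m t x \<gamma> = path_steps (horizon D)
    (\<lambda>s P z. next_state D s z m (\<gamma> s z)) t (return_pmf x) (horizon D - t)"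

definition cost ::
    "('s, 'a) mfg \<Rightarrow> (nat \<Rightarrow> 's) pmf \<Rightarrow> nat \<Rightarrow> (nat \<Rightarrow> 's) \<Rightarrow> ('s, 'a) control \<Rightarrow> real"
  where "cost D m t x \<gamma> = measure_pmf.expectation (player_law D m t x \<gamma>) (\<lambda>X.
    terminal_cost D X m + (\<Sum>r\<in>{t..<horizon D}. \<integral>a. running_cost D r X m a \<partial>\<gamma> r X))"

definition opt_value ::
    "('s, 'a::euclidean_space) mfg \<Rightarrow> (nat \<Rightarrow> 's) pmf \<Rightarrow> nat \<Rightarrow> (nat \<Rightarrow> 's) \<Rightarrow> real"
  where "opt_value D m t x = (INF \<gamma>\<in>relaxed_controls D. cost D m t x \<gamma>)"

definition relaxed_equilibria ::
    "('s, 'a::euclidean_space) mfg \<Rightarrow> real \<Rightarrow> nat \<Rightarrow> (nat \<Rightarrow> 's) pmf \<Rightarrow> ('s, 'a) control set"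
  where "relaxed_equilibria D \<epsilon> t \<mu> = {\<gamma> \<in> relaxed_controls D.
    \<forall>x\<in>stopped_paths (horizon D) t.
      cost D (mf_law D t \<mu> \<gamma>) t x \<gamma> \<le> opt_value D (mf_law D t \<mu> \<gamma>) t x + \<epsilon>}"

definition V_relax_eps ::
    "('s, 'a::euclidean_space) mfg \<Rightarrow> real \<Rightarrow> nat \<Rightarrow> (nat \<Rightarrow> 's) pmf
      \<Rightarrow> ((nat \<Rightarrow> 's) \<Rightarrow> real) set"
  where "V_relax_eps D \<epsilon> t \<mu> = {\<phi> \<in> L0 (count_space (stopped_paths (horizon D) t)).
    \<exists>\<gamma>\<in>relaxed_equilibria D \<epsilon> t \<mu>.
      sup_norm (stopped_paths (horizon D) t) (\<lambda>x. \<phi> x - cost D (mf_law D t \<mu> \<gamma>) t x \<gamma>) \<le> \<epsilon>}"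

definition V_relax ::
    "('s, 'a::euclidean_space) mfg \<Rightarrow> nat \<Rightarrow> (nat \<Rightarrow> 's) pmf \<Rightarrow> ((nat \<Rightarrow> 's) \<Rightarrow> real) set"
  where "V_relax D t \<mu> = (\<Inter>\<epsilon>\<in>{0<..}. V_relax_eps D \<epsilon> t \<mu>)"

definition cost_until ::
    "('s, 'a) mfg \<Rightarrow> nat \<Rightarrow> ((nat \<Rightarrow> 's) \<times> (nat \<Rightarrow> 's) pmf \<Rightarrow> real)
      \<Rightarrow> nat \<Rightarrow> (nat \<Rightarrow> 's) pmf \<Rightarrow> ('s, 'a) control \<Rightarrow> (nat \<Rightarrow> 's) \<Rightarrow> ('s, 'a) control \<Rightarrow> real"
  where "cost_until D T\<^sub>0 \<psi> t \<mu> \<gamma> x \<gamma>' =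
    measure_pmf.expectation (player_law D (mf_law D t \<mu> \<gamma>) t x \<gamma>') (\<lambda>X.
      \<psi> (stop (horizon D) T\<^sub>0 X, stop_law (horizon D) T\<^sub>0 (mf_law D t \<mu> \<gamma>))
      + (\<Sum>s\<in>{t..<T\<^sub>0}. \<integral>a. running_cost D s X (mf_law D t \<mu> \<gamma>) a \<partial>\<gamma>' s X))"

definition relaxed_equilibria_until ::
    "('s, 'a::euclidean_space) mfg \<Rightarrow> real \<Rightarrow> nat \<Rightarrow> ((nat \<Rightarrow> 's) \<times> (nat \<Rightarrow> 's) pmf \<Rightarrow> real)
      \<Rightarrow> nat \<Rightarrow> (nat \<Rightarrow> 's) pmf \<Rightarrow> ('s, 'a) control set"
  where "relaxed_equilibria_until D \<epsilon> T\<^sub>0 \<psi> t \<mu> = {\<gamma> \<in> relaxed_controls D.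
    \<forall>x\<in>stopped_paths (horizon D) t.
      cost_until D T\<^sub>0 \<psi> t \<mu> \<gamma> x \<gamma>
        \<le> (INF \<gamma>'\<in>relaxed_controls D. cost_until D T\<^sub>0 \<psi> t \<mu> \<gamma> x \<gamma>') + \<epsilon>}"

subsection \<open>The path laws have the prescribed initial laws and transition probabilities\<close>

lemma prob_algebra_on:
  assumes "\<pi> \<in> space (prob_algebra (restrict_space borel A))"
  shows "prob_space \<pi>" "sets \<pi> = sets (restrict_space borel A)" "space \<pi> = A"
  using assms sets_eq_imp_space_eq[of \<pi> "restrict_space borel A"]
  by (auto simp: space_prob_algebra space_restrict_space)

lemma stop_in_paths: "stop T t x \<in> paths T"
  by (auto simp: stop_def paths_def)

lemma stop_stop: "s \<le> t \<Longrightarrow> stop T s (stop T t x) = stop T s x"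
  by (auto simp: stop_def restrict_def fun_eq_iff min_def)

lemma stopped_paths_iff: "x \<in> stopped_paths T t \<longleftrightarrow> stop T t x = x"
  unfolding stopped_paths_def using stop_stop[of t t T] stop_in_paths[of T t x] by (metis image_iff order_refl)

lemma stopped_paths_subset: "stopped_paths T t \<subseteq> paths T"
  by (auto simp: stopped_paths_def stop_in_paths)

lemma stop_horizon: "x \<in> paths T \<Longrightarrow> stop T T x = x"
  by (auto simp: stop_def paths_def fun_eq_iff PiE_iff extensional_def min_def)

lemma finite_paths: "finite (paths T :: (nat \<Rightarrow> 's::finite) set)"
  by (auto simp: paths_def intro!: finite_PiE)

lemma append_state_in: "append_state T s x y \<in> stopped_paths T (Suc s)"
  by (auto simp: stopped_paths_iff stop_def append_state_def fun_eq_iff min_def)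

lemma stop_append_state: "stop T s (append_state T s x y) = stop T s x"
  by (auto simp: stop_def append_state_def fun_eq_iff min_def)

lemma append_state_eqI:
  assumes "z \<in> stopped_paths T (Suc s)" "s < T"
  shows "append_state T s (stop T s z) (z (Suc s)) = z"
proof
  fix r
  have *: "stop T (Suc s) z r = z r" using assms by (simp add: stopped_paths_iff)
  consider "r \<le> s" | "s < r" "r \<le> T" | "T < r" by linarith
  then show "append_state T s (stop T s z) (z (Suc s)) r = z r"
  proof cases
    case 1
    then show ?thesis using assms(2) by (simp add: stop_def append_state_def min_def)
  next
    case 2
    then have "z r = z (Suc s)"
      using * by (cases "r = Suc s") (simp_all add: stop_def min_def)
    then show ?thesis using 2 by (simp add: append_state_def)
  next
    case 3
    then show ?thesis using * by (simp add: append_state_def stop_def)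
  qed
qed

lemma path_steps_in:
  "\<nu> \<in> probs (stopped_paths T t) \<Longrightarrow> path_steps T \<kappa> t \<nu> n \<in> probs (stopped_paths T (t + n))"
  by (cases n) (auto simp: probs_def append_state_in)

lemma stop_path_steps_Suc:
  assumes "\<nu> \<in> probs (stopped_paths T t)"
  shows "stop_law T (t + n) (path_steps T \<kappa> t \<nu> (Suc n)) = path_steps T \<kappa> t \<nu> n"
proof -
  have "stop_law T (t + n) (path_steps T \<kappa> t \<nu> (Suc n))
      = bind_pmf (path_steps T \<kappa> t \<nu> n) (\<lambda>x. return_pmf (stop T (t + n) x))"
    by (simp add: stop_law_def map_bind_pmf map_pmf_comp stop_append_state map_pmf_const)
  also have "\<dots> = bind_pmf (path_steps T \<kappa> t \<nu> n) return_pmf"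
    using path_steps_in[OF assms, of \<kappa> n]
    by (intro bind_pmf_cong) (auto simp: probs_def stopped_paths_iff)
  finally show ?thesis by (simp add: bind_return_pmf')
qed

lemma stop_law_stop_law: "s \<le> t \<Longrightarrow> stop_law T s (stop_law T t \<mu>) = stop_law T s \<mu>"
  by (simp add: stop_law_def map_pmf_comp stop_stop)

lemma stop_law_id: "\<mu> \<in> probs (stopped_paths T t) \<Longrightarrow> stop_law T t \<mu> = \<mu>"
  unfolding stop_law_def probs_def
  by (auto simp: stopped_paths_iff intro!: map_pmf_idI)

lemma stop_path_steps:
  assumes "\<nu> \<in> probs (stopped_paths T t)" "n \<le> k"
  shows "stop_law T (t + n) (path_steps T \<kappa> t \<nu> k) = path_steps T \<kappa> t \<nu> n"
  using assms(2)
proof (induction k rule: dec_induct)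
  case base
  show ?case using path_steps_in[OF assms(1)] by (rule stop_law_id)
next
  case (step k)
  then show ?case
    using stop_law_stop_law[of "t + n" "t + k" T "path_steps T \<kappa> t \<nu> (Suc k)"]
    by (simp only: stop_path_steps_Suc[OF assms(1)])
qed

lemma pmf_path_steps_Suc:
  assumes "\<nu> \<in> probs (stopped_paths T t)" "t + n < T" "x \<in> stopped_paths T (t + n)"
  shows "pmf (path_steps T \<kappa> t \<nu> (Suc n)) (append_state T (t + n) x y)
    = pmf (path_steps T \<kappa> t \<nu> n) x * pmf (\<kappa> (t + n) (path_steps T \<kappa> t \<nu> n) x) y"
proof -
  let ?P = "path_steps T \<kappa> t \<nu> n" and ?f = "append_state T (t + n)"
  let ?K = "\<lambda>z. map_pmf (?f z) (\<kappa> (t + n) ?P z)"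
  have inj: "inj (?f x)"
  proof
    fix y y' assume "?f x y = ?f x y'"
    then have "?f x y (Suc (t + n)) = ?f x y' (Suc (t + n))" by simp
    then show "y = y'" using assms(2) by (simp add: append_state_def)
  qed
  have zero: "pmf (?K z) (?f x y) = 0" if "z \<in> set_pmf ?P" "z \<noteq> x" for z
  proof -
    have "stop T (t + n) z = z" "stop T (t + n) x = x"
      using that path_steps_in[OF assms(1), of \<kappa> n] assms(3)
      by (auto simp: probs_def stopped_paths_iff)
    then have "?f x y \<noteq> ?f z y'" for y' using stop_append_state that(2) by metis
    then show ?thesis by (auto simp: pmf_eq_0_set_pmf)
  qed
  have "pmf (path_steps T \<kappa> t \<nu> (Suc n)) (?f x y)
      = measure_pmf.expectation ?P (\<lambda>z. pmf (?K z) (?f x y))"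
    by (simp add: pmf_bind)
  also have "\<dots> = measure_pmf.expectation ?P
      (\<lambda>z. indicator {x} z * pmf (?K x) (?f x y))"
    using zero by (intro integral_cong_AE) (auto simp: AE_measure_pmf_iff indicator_def)
  also have "\<dots> = pmf ?P x * pmf (?K x) (?f x y)"
    by (simp add: measure_pmf_single)
  also have "pmf (?K x) (?f x y) = pmf (\<kappa> (t + n) ?P x) y"
    using inj by (rule pmf_map_inj')
  finally show ?thesis .
qed

lemma prob_path_steps:
  fixes T \<kappa> t \<nu>
  defines "P \<equiv> path_steps T \<kappa> t \<nu> (T - t)"
  assumes \<nu>: "\<nu> \<in> probs (stopped_paths T t)" and s: "t \<le> s" "s < T"
    and x: "x \<in> stopped_paths T s"
  shows "measure_pmf.prob P {X. stop T s X = x \<and> X (Suc s) = y}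
    = measure_pmf.prob P {X. stop T s X = x} * pmf (\<kappa> s (stop_law T s P) x) y"
proof -
  define n where "n = s - t"
  have tn: "t + n = s" using s by (simp add: n_def)
  have P0: "stop_law T s P = path_steps T \<kappa> t \<nu> n"
    using stop_path_steps[OF \<nu>, of n "T - t" \<kappa>] s tn by (simp add: P_def)
  have P1: "stop_law T (Suc s) P = path_steps T \<kappa> t \<nu> (Suc n)"
    using stop_path_steps[OF \<nu>, of "Suc n" "T - t" \<kappa>] s tn by (simp add: P_def)
  have "stop T s X = x \<and> X (Suc s) = y \<longleftrightarrow> stop T (Suc s) X = append_state T s x y" for X
  proof
    assume "stop T s X = x \<and> X (Suc s) = y"
    moreover have "stop T (Suc s) X (Suc s) = X (Suc s)" using s by (simp add: stop_def)
    ultimately show "stop T (Suc s) X = append_state T s x y"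
      using append_state_eqI[of "stop T (Suc s) X" T s] s stop_stop[of s "Suc s" T X]
      by (simp add: stopped_paths_iff stop_stop)
  next
    assume *: "stop T (Suc s) X = append_state T s x y"
    have "stop T s X = stop T s (append_state T s x y)"
      using stop_stop[of s "Suc s" T X] * by simp
    then have "stop T s X = x" using x by (simp add: stop_append_state stopped_paths_iff)
    moreover have "X (Suc s) = y"
      using fun_cong[OF *, of "Suc s"] s by (simp add: stop_def append_state_def)
    ultimately show "stop T s X = x \<and> X (Suc s) = y" by simp
  qed
  then have "measure_pmf.prob P {X. stop T s X = x \<and> X (Suc s) = y}
      = pmf (stop_law T (Suc s) P) (append_state T s x y)"
    by (simp add: stop_law_def pmf_map vimage_def)
  also have "\<dots> = pmf (stop_law T s P) x * pmf (\<kappa> s (stop_law T s P) x) y"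
    using pmf_path_steps_Suc[OF \<nu>, of n x \<kappa> y] s x by (simp only: P0 P1 tn)
  also have "pmf (stop_law T s P) x = measure_pmf.prob P {X. stop T s X = x}"
    by (simp add: stop_law_def pmf_map vimage_def)
  finally show ?thesis .
qed

context mean_field_game
begin

abbreviation (input) T where "T \<equiv> horizon D"

lemma stop_law_in: "stop_law T s \<mu> \<in> probs (paths T)"
  by (auto simp: stop_law_def probs_def stop_in_paths)

lemma transition_integrable:
  assumes "s \<le> T" "x \<in> paths T" "m \<in> probs (paths T)"
    and "\<pi> \<in> space (prob_algebra (restrict_space borel (actions D)))"
  shows "integrable \<pi> (\<lambda>a. transition D s x m a y)"
proof -
  have \<pi>: "prob_space \<pi>" "sets \<pi> = sets (restrict_space borel (actions D))"
    and space: "space \<pi> = actions D"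
    using prob_algebra_on[OF assms(4)] by auto
  have range: "0 \<le> transition D s x m a y" "transition D s x m a y \<le> 1"
    if "a \<in> space \<pi>" for a y
    using transition_range[OF assms(1-3), of a y] space that by simp_all
  interpret prob_space \<pi> by fact
  have "W1 (paths T) m m = 0" by (simp add: W1_def)
  then have lip: "\<bar>transition D s x m a y - transition D s x m a' y\<bar> \<le> \<bar>L\<^sub>q\<bar> * dist a a'"
    if "a \<in> actions D" "a' \<in> actions D" for a a'
    using transition_lipschitz[OF assms(1-3,3) that, of y]
    by (simp add: dist_norm) (meson abs_ge_self mult_right_mono norm_ge_zero order_trans)
  have "\<bar>L\<^sub>q\<bar>-lipschitz_on (actions D) (\<lambda>a. transition D s x m a y)"
    by (intro lipschitz_onI) (auto simp: dist_real_def intro: lip)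
  then have "continuous_on (actions D) (\<lambda>a. transition D s x m a y)"
    by (rule lipschitz_on_continuous_on)
  then have "(\<lambda>a. transition D s x m a y) \<in> borel_measurable (restrict_space borel (actions D))"
    by (rule borel_measurable_continuous_on_restrict)
  then have "(\<lambda>a. transition D s x m a y) \<in> borel_measurable \<pi>"
    using measurable_cong_sets[OF \<pi>(2) refl] by blast
  moreover have "AE a in \<pi>. norm (transition D s x m a y) \<le> 1"
    using range by (intro AE_I2) simp
  ultimately show ?thesis by (intro integrable_const_bound)
qed

lemma pmf_next_state:
  assumes "s \<le> T" "x \<in> paths T" "m \<in> probs (paths T)"
    and "\<pi> \<in> space (prob_algebra (restrict_space borel (actions D)))"
  shows "pmf (next_state D s x m \<pi>) y = (\<integral>a. transition D s x m a y \<partial>\<pi>)"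
proof -
  have \<pi>: "prob_space \<pi>" "sets \<pi> = sets (restrict_space borel (actions D))"
    and space: "space \<pi> = actions D"
    using prob_algebra_on[OF assms(4)] by auto
  have range: "0 \<le> transition D s x m a y" "transition D s x m a y \<le> 1"
    if "a \<in> space \<pi>" for a y
    using transition_range[OF assms(1-3), of a y] space that by simp_all
  interpret prob_space \<pi> by fact
  have nonneg: "0 \<le> (\<integral>a. transition D s x m a y \<partial>\<pi>)" for y
    by (intro integral_nonneg_AE AE_I2 range)
  have "(\<Sum>y\<in>UNIV. \<integral>a. transition D s x m a y \<partial>\<pi>)
      = (\<integral>a. (\<Sum>y\<in>UNIV. transition D s x m a y) \<partial>\<pi>)"
    using transition_integrable[OF assms] by (simp add: Bochner_Integration.integral_sum)
  also have "\<dots> = (\<integral>a. 1 \<partial>\<pi>)"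
    using transition_sum[OF assms(1-3)] space by (intro Bochner_Integration.integral_cong) auto
  finally have "(\<Sum>y\<in>UNIV. \<integral>a. transition D s x m a y \<partial>\<pi>) = 1" by (simp add: prob_space)
  then show ?thesis
    unfolding next_state_def using nonneg
    by (subst pmf_embed_pmf) (auto simp: nn_integral_count_space_finite sum_ennreal)
qed

lemma pmf_next_state_stop:
  assumes "s \<le> T" "x \<in> paths T" "m \<in> probs (paths T)" "\<gamma> \<in> relaxed_controls D"
  shows "pmf (next_state D s (stop T s x) (stop_law T s m) (\<gamma> s (stop T s x))) y
      = (\<integral>a. transition D s x m a y \<partial>\<gamma> s x)"
    and "pmf (next_state D s (stop T s x) m (\<gamma> s (stop T s x))) y
      = (\<integral>a. transition D s x m a y \<partial>\<gamma> s x)"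
proof -
  have "\<forall>t\<le>T. \<forall>x\<in>paths T.
      \<gamma> t x \<in> space (prob_algebra (restrict_space borel (actions D))) \<and> \<gamma> t x = \<gamma> t (stop T t x)"
    using assms(4) by (simp only: relaxed_controls_def mem_Collect_eq)
  note * = this[rule_format, OF assms(1,2)]
  have \<gamma>: "\<gamma> s (stop T s x) = \<gamma> s x"
      "\<gamma> s x \<in> space (prob_algebra (restrict_space borel (actions D)))"
    by (fact *[THEN conjunct2, symmetric], fact *[THEN conjunct1])
  have space: "space (\<gamma> s x) = actions D"
    by (rule prob_algebra_on(3)[OF \<gamma>(2)])
  have 1: "transition D s (stop T s x) (stop_law T s m) a y = transition D s x m a y"
    if "a \<in> actions D" for a
    by (rule transition_adapted[OF assms(1-3) that, symmetric])
  have 2: "transition D s (stop T s x) m a y = transition D s x m a y" if "a \<in> actions D" for a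
    using transition_adapted[OF assms(1) stop_in_paths assms(3) that, where y = y] 1[OF that]
    by (simp add: stop_stop)
  show "pmf (next_state D s (stop T s x) (stop_law T s m) (\<gamma> s (stop T s x))) y
      = (\<integral>a. transition D s x m a y \<partial>\<gamma> s x)"
    unfolding \<gamma>(1) pmf_next_state[OF assms(1) stop_in_paths stop_law_in \<gamma>(2)]
    by (rule Bochner_Integration.integral_cong) (auto simp: space 1)
  show "pmf (next_state D s (stop T s x) m (\<gamma> s (stop T s x))) y
      = (\<integral>a. transition D s x m a y \<partial>\<gamma> s x)"
    unfolding \<gamma>(1) pmf_next_state[OF assms(1) stop_in_paths assms(3) \<gamma>(2)]
    by (rule Bochner_Integration.integral_cong) (auto simp: space 2)
qed

lemma mf_law_initial:
  assumes "t \<le> T" "\<mu> \<in> probs (stopped_paths T t)"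
  shows "stop_law T t (mf_law D t \<mu> \<gamma>) = \<mu>"
  using stop_path_steps[OF assms(2), of 0] by (simp add: mf_law_def)

lemma path_steps_paths:
  "t \<le> T \<Longrightarrow> \<nu> \<in> probs (stopped_paths T t) \<Longrightarrow> path_steps T \<kappa> t \<nu> (T - t) \<in> probs (paths T)"
  using path_steps_in[of \<nu> T t \<kappa> "T - t"] stopped_paths_subset[of T T] by (auto simp: probs_def)

lemma mf_law_transition:
  assumes "\<mu> \<in> probs (stopped_paths T t)" "\<gamma> \<in> relaxed_controls D"
    and "t \<le> s" "s < T" "x \<in> paths T"
  defines "P \<equiv> mf_law D t \<mu> \<gamma>"
  shows "measure_pmf.prob P {X. stop T s X = stop T s x \<and> X (Suc s) = y}
    = measure_pmf.prob P {X. stop T s X = stop T s x} * (\<integral>a. transition D s x P a y \<partial>\<gamma> s x)"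
proof -
  have "P \<in> probs (paths T)" using assms by (auto simp: P_def mf_law_def intro: path_steps_paths)
  then show ?thesis
    using prob_path_steps[OF assms(1,3,4), of "stop T s x" "\<lambda>s P x. next_state D s x P (\<gamma> s x)" y]
      pmf_next_state_stop(1)[of s x P \<gamma> y] assms
    by (simp add: stopped_paths_iff stop_stop mf_law_def)
qed

lemma player_law_initial:
  assumes "t \<le> T" "x \<in> stopped_paths T t"
  shows "stop_law T t (player_law D m t x \<gamma>) = return_pmf x"
  using stop_path_steps[of "return_pmf x" T t 0] assms by (simp add: player_law_def probs_def)

lemma player_law_transition:
  assumes "m \<in> probs (paths T)" "x \<in> stopped_paths T t" "\<gamma> \<in> relaxed_controls D"
    and "t \<le> s" "s < T" "z \<in> paths T"
  defines "P \<equiv> player_law D m t x \<gamma>"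
  shows "measure_pmf.prob P {X. stop T s X = stop T s z \<and> X (Suc s) = y}
    = measure_pmf.prob P {X. stop T s X = stop T s z} * (\<integral>a. transition D s z m a y \<partial>\<gamma> s z)"
  using prob_path_steps[of "return_pmf x" T t s "stop T s z"
      "\<lambda>s P z. next_state D s z m (\<gamma> s z)" y]
    pmf_next_state_stop(2)[of s z m \<gamma> y] assms
  by (simp add: stopped_paths_iff stop_stop player_law_def probs_def)

end

end

theory Submission
  imports Defs
begin

text \<open>
  For a fixed environment the problem of a single player is a finite control problem, so its cost
  from time \<open>t\<close> is the running cost up to an intermediate time \<open>\<tau>\<close> plus the expected cost from
  \<open>\<tau>\<close>. An approximate equilibrium from \<open>t\<close> remains one from \<open>\<tau>\<close>, with the error multiplied by at
  most \<open>c\<^sub>q\<^bsup>t-\<tau>\<^esup>\<close>, because every path compatible with the initial one is reached with probability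
  at least \<open>c\<^sub>q\<^bsup>\<tau>-t\<^esup>\<close>; as terminal function one takes its own cost at \<open>\<tau>\<close>. Conversely, an
  \<open>\<epsilon>\<close>-equilibrium on \<open>{t..\<tau>}\<close> followed by the \<open>\<epsilon>\<close>-equilibrium behind the terminal function is
  a \<open>4\<epsilon>\<close>-equilibrium, since by adaptedness the environment up to \<open>\<tau>\<close> does not notice the change
  of control after \<open>\<tau>\<close>.
\<close>

subsection \<open>Stopped paths and their laws\<close>

text \<open>The kernel depends only on the current time, law and path, so the recursion can be
  restarted at \<open>t + k\<close> from the law reached there.\<close>

lemma path_steps_add:
  "path_steps N \<kappa> t \<nu> (k + n) = path_steps N \<kappa> (t + k) (path_steps N \<kappa> t \<nu> k) n"
  by (induction n) (simp_all add: add.assoc)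

text \<open>A kernel that does not feed back the current law acts linearly on mixtures of initial
  laws. This is the case of a fixed environment, in contrast to the mean field flow.\<close>

lemma path_steps_bind:
  "path_steps N (\<lambda>s P. K s) t (bind_pmf M f) n
    = bind_pmf M (\<lambda>x. path_steps N (\<lambda>s P. K s) t (f x) n)"
  by (induction n) (simp_all add: bind_assoc_pmf)

text \<open>Agreement is asked only at the laws and paths which the first flow reaches, because
  adaptedness of the data is known only on genuine paths.\<close>

lemma path_steps_cong:
  assumes "\<And>j x. j < n \<Longrightarrow> x \<in> set_pmf (path_steps N \<kappa> t \<nu> j)
    \<Longrightarrow> \<kappa> (t + j) (path_steps N \<kappa> t \<nu> j) x = \<kappa>' (t + j) (path_steps N \<kappa> t \<nu> j) x"
  shows "path_steps N \<kappa> t \<nu> n = path_steps N \<kappa>' t \<nu> n"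
  using assms
proof (induction n)
  case (Suc n)
  then have IH: "path_steps N \<kappa>' t \<nu> n = path_steps N \<kappa> t \<nu> n" by simp
  show ?case
    unfolding path_steps.simps IH using Suc.prems by (intro bind_pmf_cong) auto
qed simp

text \<open>Stopping the law at \<open>t\<close> gives back the Dirac mass at \<open>x\<close>, so
  no path of positive mass differs from \<open>x\<close> up to time \<open>t\<close>.\<close>

lemma set_path_steps_return:
  assumes "x \<in> stopped_paths N t" "X \<in> set_pmf (path_steps N \<kappa> t (return_pmf x) n)"
  shows "stop N t X = x" "X \<in> stopped_paths N (t + n)"
proof -
  have x: "return_pmf x \<in> probs (stopped_paths N t)"
    using assms(1) by (simp add: probs_def)
  have "map_pmf (stop N t) (path_steps N \<kappa> t (return_pmf x) n) = return_pmf x"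
    using stop_path_steps[OF x, of 0 n] by (simp add: stop_law_def)
  then have "stop N t ` set_pmf (path_steps N \<kappa> t (return_pmf x) n) = {x}"
    by (metis set_map_pmf set_return_pmf)
  then show "stop N t X = x" using assms(2) by blast
  show "X \<in> stopped_paths N (t + n)"
    using path_steps_in[OF x] assms(2) by (auto simp: probs_def)
qed

lemma stopped_paths_step:
  assumes "z \<in> stopped_paths N (Suc s)" "s < N"
  obtains x y where "x \<in> stopped_paths N s" "z = append_state N s x y" "x = stop N s z"
proof
  show "stop N s z \<in> stopped_paths N s" by (simp add: stopped_paths_iff stop_stop)
  show "z = append_state N s (stop N s z) (z (Suc s))"
    by (rule append_state_eqI[OF assms, symmetric])
qed (rule refl)

text \<open>Each stopped path at time \<open>s + 1\<close> extends one at time \<open>s\<close> by a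
  single state, and a next-state law of full support charges all these extensions. So full support
  propagates from step to step.\<close>

lemma set_path_steps_full:
  assumes "\<nu> \<in> full_probs (stopped_paths N t)" "t + n \<le> N"
    and "\<And>s P x. \<lbrakk>t \<le> s; s < N; P \<in> probs (paths N); x \<in> stopped_paths N s\<rbrakk>
      \<Longrightarrow> set_pmf (\<kappa> s P x) = UNIV"
  shows "path_steps N \<kappa> t \<nu> n \<in> full_probs (stopped_paths N (t + n))"
  using assms(2)
proof (induction n)
  case 0
  then show ?case using assms(1) by simp
next
  case (Suc n)
  let ?P = "path_steps N \<kappa> t \<nu> n"
  have \<nu>: "\<nu> \<in> probs (stopped_paths N t)" using assms(1) by (simp add: full_probs_def probs_def)
  have IH: "set_pmf ?P = stopped_paths N (t + n)" using Suc by (simp add: full_probs_def)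
  have P: "?P \<in> probs (paths N)"
    using IH stopped_paths_subset by (auto simp: probs_def)
  have "z \<in> set_pmf (path_steps N \<kappa> t \<nu> (Suc n))" if z: "z \<in> stopped_paths N (Suc (t + n))" for z
  proof -
    obtain x y where xy: "x \<in> stopped_paths N (t + n)" "z = append_state N (t + n) x y"
      using stopped_paths_step[OF z] Suc.prems by (metis Suc_le_eq add_Suc_right)
    have "set_pmf (\<kappa> (t + n) ?P x) = UNIV" using Suc.prems by (intro assms(3) P xy(1)) auto
    then have "y \<in> set_pmf (\<kappa> (t + n) ?P x)" by blast
    moreover have "x \<in> set_pmf ?P" using IH xy(1) by blast
    ultimately show ?thesis unfolding path_steps.simps set_bind_pmf set_map_pmf xy(2) by blast
  qed
  moreover have "set_pmf (path_steps N \<kappa> t \<nu> (Suc n)) \<subseteq> stopped_paths N (Suc (t + n))"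
    using path_steps_in[OF \<nu>, of \<kappa> "Suc n"] by (simp only: probs_def mem_Collect_eq add_Suc_right)
  ultimately show ?case unfolding full_probs_def add_Suc_right by blast
qed

text \<open>A path is reached by \<open>n\<close> successive transitions, each of probability at
  least \<open>c\<close>, and these probabilities multiply. With \<open>c = c\<^sub>q\<close> this
  is the source of the factor \<open>c\<^sub>q ^ (\<tau> - t)\<close>.\<close>

lemma pmf_path_steps_lower:
  assumes "x \<in> stopped_paths N t" "t + n \<le> N" "0 \<le> c"
    and "\<And>s z y. \<lbrakk>t \<le> s; s < N; z \<in> stopped_paths N s\<rbrakk> \<Longrightarrow> c \<le> pmf (K s z) y"
    and "z \<in> stopped_paths N (t + n)" "stop N t z = x"
  shows "c ^ n \<le> pmf (path_steps N (\<lambda>s P. K s) t (return_pmf x) n) z"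
  using assms(2,5,6)
proof (induction n arbitrary: z)
  case 0
  then show ?case by (simp add: stopped_paths_iff)
next
  case (Suc n)
  let ?P = "path_steps N (\<lambda>s P. K s) t (return_pmf x)"
  have \<nu>: "return_pmf x \<in> probs (stopped_paths N t)" using assms(1) by (simp add: probs_def)
  have "z \<in> stopped_paths N (Suc (t + n))" "t + n < N" using Suc.prems by auto
  then obtain w y where wy: "w \<in> stopped_paths N (t + n)" "z = append_state N (t + n) w y"
      "w = stop N (t + n) z"
    by (rule stopped_paths_step)
  have "stop N t w = x" using wy(3) Suc.prems stop_stop[of t "t + n" N z] by simp
  then have "c ^ n \<le> pmf (?P n) w" using Suc.prems(1) wy(1) by (intro Suc.IH) auto
  moreover have "c \<le> pmf (K (t + n) w) y" using Suc.prems(1) wy(1) by (intro assms(4)) auto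
  ultimately have "c ^ n * c \<le> pmf (?P n) w * pmf (K (t + n) w) y"
    using assms(3) by (intro mult_mono) auto
  then show ?case
    using pmf_path_steps_Suc[OF \<nu> \<open>t + n < N\<close> wy(1), of "\<lambda>s P. K s" y] wy(2)
    by (simp only: power_Suc2)
qed

text \<open>A real supremum is characterised by its upper bounds only for nonempty bounded sets;
  finiteness of \<open>E\<close> supplies the boundedness.\<close>

lemma sup_norm_le_iff:
  assumes "finite E" "E \<noteq> {}"
  shows "sup_norm E f \<le> c \<longleftrightarrow> (\<forall>x\<in>E. \<bar>f x\<bar> \<le> c)"
  unfolding sup_norm_def using assms by (subst cSUP_le_iff) auto

lemma space_full_probs_space: "space (full_probs_space E) = full_probs E"
  by (simp add: full_probs_space_def space_measure_of_conv)

lemma finite_stopped_paths: "finite (stopped_paths N t :: (nat \<Rightarrow> 's::finite) set)"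
  using finite_subset[OF stopped_paths_subset finite_paths] .

lemma stopped_paths_nonempty: "stopped_paths N t \<noteq> {}"
  by (simp add: stopped_paths_def paths_def PiE_eq_empty_iff)

subsection \<open>Controls and dynamic programming in a fixed environment\<close>

text \<open>Two uses are covered: \<open>S = UNIV\<close> concatenates two controls at
  \<open>\<tau>\<close>, and \<open>S = {z}\<close> is a deviation that starts only after
  \<open>z\<close> has been reached. Testing the stopped path rather than \<open>x\<close> keeps the
  control adapted.\<close>

definition switch_control ::
    "nat \<Rightarrow> nat \<Rightarrow> (nat \<Rightarrow> 's) set \<Rightarrow> ('s, 'a) control \<Rightarrow> ('s, 'a) control \<Rightarrow> ('s, 'a) control"
  where "switch_control N \<tau> S \<gamma> \<gamma>' s x = (if \<tau> \<le> s \<and> stop N \<tau> x \<in> S then \<gamma>' s x else \<gamma> s x)"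

lemma relaxed_controlsD:
  assumes "\<gamma> \<in> relaxed_controls D" "s \<le> horizon D" "x \<in> paths (horizon D)"
  shows "\<gamma> s x \<in> space (prob_algebra (restrict_space borel (actions D)))"
    and "\<gamma> s (stop (horizon D) s x) = \<gamma> s x"
proof -
  have "\<forall>t\<le>horizon D. \<forall>x\<in>paths (horizon D).
      \<gamma> t x \<in> space (prob_algebra (restrict_space borel (actions D)))
      \<and> \<gamma> t x = \<gamma> t (stop (horizon D) t x)"
    using assms(1) by (simp only: relaxed_controls_def mem_Collect_eq)
  note * = this[rule_format, OF assms(2,3)]
  show "\<gamma> s x \<in> space (prob_algebra (restrict_space borel (actions D)))"
    by (fact *[THEN conjunct1])
  show "\<gamma> s (stop (horizon D) s x) = \<gamma> s x"
    by (fact *[THEN conjunct2, symmetric])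
qed

lemma switch_control_relaxed:
  fixes D :: "('s, 'a::euclidean_space) mfg"
  assumes "\<gamma> \<in> relaxed_controls D" "\<gamma>' \<in> relaxed_controls D"
  shows "switch_control (horizon D) \<tau> S \<gamma> \<gamma>' \<in> relaxed_controls D"
  unfolding relaxed_controls_def
proof (intro CollectI allI impI ballI)
  fix s and x :: "nat \<Rightarrow> 's" assume "s \<le> horizon D" "x \<in> paths (horizon D)"
  note D = relaxed_controlsD[OF assms(1) this] relaxed_controlsD[OF assms(2) this]
  show "switch_control (horizon D) \<tau> S \<gamma> \<gamma>' s x
        \<in> space (prob_algebra (restrict_space borel (actions D))) \<and>
      switch_control (horizon D) \<tau> S \<gamma> \<gamma>' s x
        = switch_control (horizon D) \<tau> S \<gamma> \<gamma>' s (stop (horizon D) s x)"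
    \<comment> \<open>For \<open>\<tau> \<le> s\<close>, stopping at \<open>s\<close> leaves the
      path up to \<open>\<tau>\<close>, and with it the membership test, unchanged; for
      \<open>s < \<tau>\<close> only \<open>\<gamma>\<close> is consulted.\<close>
    unfolding switch_control_def by (cases "\<tau> \<le> s") (simp_all add: D stop_stop)
qed

section \<open>Laws and costs up to an intermediate time\<close>

definition stage_cost ::
    "('s, 'a) mfg \<Rightarrow> (nat \<Rightarrow> 's) pmf \<Rightarrow> ('s, 'a) control \<Rightarrow> nat \<Rightarrow> (nat \<Rightarrow> 's) \<Rightarrow> real"
  where "stage_cost D m \<gamma> r x = (\<integral>a. running_cost D r x m a \<partial>\<gamma> r x)"

text \<open>\<open>player_law\<close> with a free number of steps, so that it can be cut and
  restarted at intermediate times.\<close>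

definition player_steps ::
    "('s, 'a) mfg \<Rightarrow> (nat \<Rightarrow> 's) pmf \<Rightarrow> ('s, 'a) control \<Rightarrow> nat \<Rightarrow> (nat \<Rightarrow> 's) \<Rightarrow> nat
      \<Rightarrow> (nat \<Rightarrow> 's) pmf"
  where "player_steps D m \<gamma> t x n =
    path_steps (horizon D) (\<lambda>s P z. next_state D s z m (\<gamma> s z)) t (return_pmf x) n"

text \<open>The counterpart of \<open>cost_until\<close> in which the environment and the terminal
  function are free parameters and the law runs only up to \<open>\<tau>\<close>. With the cost from
  \<open>\<tau>\<close> as \<open>g\<close> it is the right-hand side of the dynamic programming
  equation.\<close>

definition cost_to ::
    "('s, 'a) mfg \<Rightarrow> (nat \<Rightarrow> 's) pmf \<Rightarrow> nat \<Rightarrow> ((nat \<Rightarrow> 's) \<Rightarrow> real) \<Rightarrow> nat \<Rightarrow> (nat \<Rightarrow> 's)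
      \<Rightarrow> ('s, 'a) control \<Rightarrow> real"
  where "cost_to D m \<tau> g t x \<gamma> = measure_pmf.expectation (player_steps D m \<gamma> t x (\<tau> - t))
    (\<lambda>X. g X + (\<Sum>r\<in>{t..<\<tau>}. stage_cost D m \<gamma> r X))"

context mean_field_game
begin

lemma player_steps_in:
  assumes "x \<in> stopped_paths T t" "X \<in> set_pmf (player_steps D m \<gamma> t x n)"
  shows "stop T t X = x" "X \<in> stopped_paths T (t + n)" "X \<in> paths T"
  using set_path_steps_return[OF assms(1) assms(2)[unfolded player_steps_def]] stopped_paths_subset
  by auto

lemma finite_player_steps:
  "x \<in> stopped_paths T t \<Longrightarrow> finite (set_pmf (player_steps D m \<gamma> t x n))"
  using player_steps_in(3) by (metis finite_paths finite_subset subsetI)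

lemma player_steps_integrable:
  fixes f :: "_ \<Rightarrow> real"
  shows "x \<in> stopped_paths T t \<Longrightarrow> integrable (measure_pmf (player_steps D m \<gamma> t x n)) f"
  by (intro integrable_measure_pmf_finite finite_player_steps)

lemma player_law_eq: "player_law D m t x \<gamma> = player_steps D m \<gamma> t x (T - t)"
  by (simp add: player_law_def player_steps_def)

text \<open>The Chapman-Kolmogorov equation: the intermediate law is a mixture of Dirac masses, and
  in a fixed environment the remaining steps act linearly on it.\<close>

lemma player_steps_add:
  "player_steps D m \<gamma> t x (k + n)
    = bind_pmf (player_steps D m \<gamma> t x k) (\<lambda>z. player_steps D m \<gamma> (t + k) z n)"
proof -
  let ?\<kappa> = "\<lambda>s (P :: (nat \<Rightarrow> 's) pmf) z. next_state D s z m (\<gamma> s z)"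
  have "player_steps D m \<gamma> t x (k + n)
      = path_steps T ?\<kappa> (t + k) (bind_pmf (player_steps D m \<gamma> t x k) return_pmf) n"
    by (simp add: player_steps_def path_steps_add bind_return_pmf')
  then show ?thesis by (simp only: path_steps_bind player_steps_def)
qed

text \<open>At time \<open>r\<close> both the control and the running cost see only the path up to
  \<open>r\<close>, which stopping at a later \<open>\<tau>\<close> does not alter.\<close>

lemma stage_cost_stop:
  assumes "r \<le> \<tau>" "\<tau> \<le> T" "x \<in> paths T" "m \<in> probs (paths T)" "\<gamma> \<in> relaxed_controls D"
  shows "stage_cost D m \<gamma> r (stop T \<tau> x) = stage_cost D m \<gamma> r x"
proof -
  have r: "r \<le> T" using assms by simp
  have \<gamma>: "\<gamma> r (stop T \<tau> x) = \<gamma> r x"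
    using relaxed_controlsD(2)[OF assms(5) r, of x]
      relaxed_controlsD(2)[OF assms(5) r, of "stop T \<tau> x"] assms
    by (simp add: stop_stop stop_in_paths)
  have space: "space (\<gamma> r x) = actions D"
    by (rule prob_algebra_on(3)[OF relaxed_controlsD(1)[OF assms(5) r assms(3)]])
  show ?thesis
    unfolding stage_cost_def \<gamma>
  proof (rule Bochner_Integration.integral_cong)
    fix a assume "a \<in> space (\<gamma> r x)"
    then have a: "a \<in> actions D" using space by simp
    show "running_cost D r (stop T \<tau> x) m a = running_cost D r x m a"
      using running_cost_adapted[OF r assms(3,4) a]
        running_cost_adapted[OF r stop_in_paths assms(4) a, of \<tau> x] assms(1)
      by (simp add: stop_stop)
  qed simp
qed

text \<open>Adaptedness in the measure argument: the law stopped at \<open>s\<close> is an image of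
  the law stopped at \<open>\<tau>\<close>. This is why a change of control after
  \<open>\<tau>\<close> does not affect the game before \<open>\<tau>\<close>.\<close>

lemma environment_adapted:
  assumes "s \<le> \<tau>" "\<tau> \<le> T" "x \<in> paths T" "m \<in> probs (paths T)" "m' \<in> probs (paths T)"
    and "stop_law T \<tau> m = stop_law T \<tau> m'" "\<gamma> \<in> relaxed_controls D"
  shows "next_state D s x m (\<gamma> s x) = next_state D s x m' (\<gamma> s x)"
    and "stage_cost D m \<gamma> s x = stage_cost D m' \<gamma> s x"
proof -
  have s: "s \<le> T" using assms by simp
  have eq: "stop_law T s m = stop_law T s m'" using assms(1,6) by (metis stop_law_stop_law)
  have space: "space (\<gamma> s x) = actions D"
    by (rule prob_algebra_on(3)[OF relaxed_controlsD(1)[OF assms(7) s assms(3)]])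
  have "(\<integral>a. transition D s x m a y \<partial>\<gamma> s x) = (\<integral>a. transition D s x m' a y \<partial>\<gamma> s x)" for y
    by (rule Bochner_Integration.integral_cong)
      (auto simp: space eq transition_adapted[OF s assms(3,4)] transition_adapted[OF s assms(3,5)])
  then show "next_state D s x m (\<gamma> s x) = next_state D s x m' (\<gamma> s x)"
    by (simp add: next_state_def)
  show "stage_cost D m \<gamma> s x = stage_cost D m' \<gamma> s x"
    unfolding stage_cost_def
    by (rule Bochner_Integration.integral_cong)
      (auto simp: space eq running_cost_adapted[OF s assms(3,4)] running_cost_adapted[OF s assms(3,5)])
qed

lemma player_steps_cong:
  assumes "x \<in> stopped_paths T t"
    and "\<And>s z. \<lbrakk>t \<le> s; s < t + n; z \<in> paths T; stop T t z = x\<rbrakk>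
      \<Longrightarrow> next_state D s z m (\<gamma> s z) = next_state D s z m' (\<gamma>' s z)"
  shows "player_steps D m \<gamma> t x n = player_steps D m' \<gamma>' t x n"
  unfolding player_steps_def
proof (rule path_steps_cong)
  fix j z
  assume "j < n"
    and "z \<in> set_pmf (path_steps T (\<lambda>s P z. next_state D s z m (\<gamma> s z)) t (return_pmf x) j)"
  then show "next_state D (t + j) z m (\<gamma> (t + j) z) = next_state D (t + j) z m' (\<gamma>' (t + j) z)"
    using player_steps_in[OF assms(1), of z m \<gamma> j] by (intro assms(2)) (auto simp: player_steps_def)
qed

lemma cost_cong:
  assumes "x \<in> stopped_paths T t" "t \<le> T"
    and "\<And>s z. \<lbrakk>t \<le> s; s < T; z \<in> paths T; stop T t z = x\<rbrakk> \<Longrightarrow> \<gamma> s z = \<gamma>' s z"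
  shows "cost D m t x \<gamma> = cost D m t x \<gamma>'"
proof -
  have eq: "player_steps D m \<gamma> t x (T - t) = player_steps D m \<gamma>' t x (T - t)"
    using assms by (intro player_steps_cong) auto
  show ?thesis
    unfolding cost_def player_law_eq eq
  proof (rule integral_cong_AE)
    show "AE X in measure_pmf (player_steps D m \<gamma>' t x (T - t)).
      terminal_cost D X m + (\<Sum>r\<in>{t..<T}. \<integral>a. running_cost D r X m a \<partial>\<gamma> r X)
      = terminal_cost D X m + (\<Sum>r\<in>{t..<T}. \<integral>a. running_cost D r X m a \<partial>\<gamma>' r X)"
      using player_steps_in[OF assms(1)] assms(3)
      by (auto simp: AE_measure_pmf_iff intro!: sum.cong)
  qed auto
qed

text \<open>Serves to replace a switched control by its first piece, and the environment of the
  short game by that of a concatenated control.\<close>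

lemma cost_to_cong:
  assumes "x \<in> stopped_paths T t" "t \<le> \<tau>" "\<tau> \<le> T"
    and "m \<in> probs (paths T)" "m' \<in> probs (paths T)" "stop_law T \<tau> m = stop_law T \<tau> m'"
    and "\<gamma> \<in> relaxed_controls D"
    and "\<And>s z. s < \<tau> \<Longrightarrow> \<gamma> s z = \<gamma>' s z"
  shows "cost_to D m \<tau> g t x \<gamma> = cost_to D m' \<tau> g t x \<gamma>'"
proof -
  have adapted: "next_state D s z m (\<gamma> s z) = next_state D s z m' (\<gamma>' s z)"
      "stage_cost D m \<gamma> s z = stage_cost D m' \<gamma>' s z"
    if "s < \<tau>" "z \<in> paths T" for s z
    using environment_adapted[OF _ assms(3) that(2) assms(4-7), of s] that assms(8)[OF that(1)]
    by (simp_all add: stage_cost_def)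
  have eq: "player_steps D m \<gamma> t x (\<tau> - t) = player_steps D m' \<gamma>' t x (\<tau> - t)"
    using assms(1,2) by (intro player_steps_cong) (auto intro!: adapted)
  show ?thesis
    unfolding cost_to_def eq
  proof (rule integral_cong_AE)
    show "AE X in measure_pmf (player_steps D m' \<gamma>' t x (\<tau> - t)).
      g X + (\<Sum>r\<in>{t..<\<tau>}. stage_cost D m \<gamma> r X) = g X + (\<Sum>r\<in>{t..<\<tau>}. stage_cost D m' \<gamma>' r X)"
      using player_steps_in(3)[OF assms(1)]
      by (auto simp: AE_measure_pmf_iff intro!: sum.cong adapted)
  qed auto
qed

text \<open>Both sides carry the same running costs, and a constant has itself as expectation. Used
  in both directions with \<open>c = 0\<close>, it exchanges terminal functions that agree on the
  stopped paths at \<open>\<tau>\<close>.\<close>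

lemma cost_to_mono:
  assumes "x \<in> stopped_paths T t" "t \<le> \<tau>"
    and "\<And>z. z \<in> stopped_paths T \<tau> \<Longrightarrow> g z \<le> h z + c"
  shows "cost_to D m \<tau> g t x \<gamma> \<le> cost_to D m \<tau> h t x \<gamma> + c"
proof -
  let ?P = "player_steps D m \<gamma> t x (\<tau> - t)"
  have "cost_to D m \<tau> g t x \<gamma>
      \<le> measure_pmf.expectation ?P (\<lambda>X. (h X + (\<Sum>r\<in>{t..<\<tau>}. stage_cost D m \<gamma> r X)) + c)"
    unfolding cost_to_def
  proof (rule integral_mono_AE)
    show "AE X in measure_pmf ?P. g X + (\<Sum>r\<in>{t..<\<tau>}. stage_cost D m \<gamma> r X)
        \<le> (h X + (\<Sum>r\<in>{t..<\<tau>}. stage_cost D m \<gamma> r X)) + c"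
      using player_steps_in(2)[OF assms(1), of _ m \<gamma> "\<tau> - t"] assms(2,3)
      by (auto simp: AE_measure_pmf_iff algebra_simps)
  qed (intro player_steps_integrable assms(1))+
  also have "\<dots> = cost_to D m \<tau> h t x \<gamma> + c"
    unfolding cost_to_def
    by (subst Bochner_Integration.integral_add) (auto intro!: player_steps_integrable assms(1))
  finally show ?thesis .
qed

text \<open>The tower property, conditioning on the path at \<open>\<tau>\<close>: this path
  determines the running costs before \<open>\<tau>\<close>, and the conditional expectation of the
  rest is the cost from \<open>\<tau>\<close>.\<close>

lemma cost_dynamic_programming:
  assumes x: "x \<in> stopped_paths T t" and "t \<le> \<tau>" "\<tau> \<le> T"
    and m: "m \<in> probs (paths T)" and \<gamma>: "\<gamma> \<in> relaxed_controls D"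
  shows "cost D m t x \<gamma> = cost_to D m \<tau> (\<lambda>z. cost D m \<tau> z \<gamma>) t x \<gamma>"
proof -
  let ?P = "player_steps D m \<gamma> t x (\<tau> - t)"
  let ?f = "\<lambda>X. terminal_cost D X m + (\<Sum>r\<in>{t..<T}. stage_cost D m \<gamma> r X)"
  have z: "z \<in> stopped_paths T \<tau>" if "z \<in> set_pmf ?P" for z
    using player_steps_in(2)[OF x that] assms(2) by simp
  have "T - t = (\<tau> - t) + (T - \<tau>)" using assms by simp
  then have law: "player_law D m t x \<gamma> = bind_pmf ?P (\<lambda>z. player_steps D m \<gamma> \<tau> z (T - \<tau>))"
    using player_steps_add[of m \<gamma> t x "\<tau> - t" "T - \<tau>"] assms(2) by (simp add: player_law_eq)
  \<comment> \<open>All supports are finite, so the iterated expectation is a finite sum over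
    intermediate paths.\<close>
  have bind: "measure_pmf.expectation (bind_pmf ?P (\<lambda>z. player_steps D m \<gamma> \<tau> z (T - \<tau>))) ?f
      = measure_pmf.expectation ?P
          (\<lambda>z. measure_pmf.expectation (player_steps D m \<gamma> \<tau> z (T - \<tau>)) ?f)"
    using finite_player_steps[OF x] finite_player_steps[OF z]
    by (subst pmf_expectation_bind[of "set_pmf ?P"])
       (auto simp: integral_measure_pmf[of "set_pmf ?P"])
  have tail: "measure_pmf.expectation (player_steps D m \<gamma> \<tau> z (T - \<tau>)) ?f
      = cost D m \<tau> z \<gamma> + (\<Sum>r\<in>{t..<\<tau>}. stage_cost D m \<gamma> r z)"
    if "z \<in> set_pmf ?P" for z
  proof -
    let ?Q = "player_steps D m \<gamma> \<tau> z (T - \<tau>)"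
    have "measure_pmf.expectation ?Q ?f = measure_pmf.expectation ?Q (\<lambda>X.
        (terminal_cost D X m + (\<Sum>r\<in>{\<tau>..<T}. stage_cost D m \<gamma> r X))
        + (\<Sum>r\<in>{t..<\<tau>}. stage_cost D m \<gamma> r z))"
    proof (rule integral_cong_AE)
      have "?f X = (terminal_cost D X m + (\<Sum>r\<in>{\<tau>..<T}. stage_cost D m \<gamma> r X))
          + (\<Sum>r\<in>{t..<\<tau>}. stage_cost D m \<gamma> r z)" if X: "X \<in> set_pmf ?Q" for X
      proof -
        \<comment> \<open>Stopping \<open>X\<close> at \<open>\<tau>\<close> gives \<open>z\<close>,
          so the costs incurred before \<open>\<tau>\<close> are already fixed at
          \<open>z\<close>.\<close>
        have "stage_cost D m \<gamma> r z = stage_cost D m \<gamma> r X" if "r < \<tau>" for r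
          using stage_cost_stop[of r \<tau> X m \<gamma>] player_steps_in[OF z X] \<open>z \<in> set_pmf ?P\<close> that assms
          by auto
        moreover have "(\<Sum>r\<in>{t..<T}. stage_cost D m \<gamma> r X)
            = (\<Sum>r\<in>{t..<\<tau>}. stage_cost D m \<gamma> r X) + (\<Sum>r\<in>{\<tau>..<T}. stage_cost D m \<gamma> r X)"
          using assms by (simp add: sum.atLeastLessThan_concat)
        ultimately show ?thesis by (simp add: algebra_simps)
      qed
      then show "AE X in measure_pmf ?Q. ?f X
          = (terminal_cost D X m + (\<Sum>r\<in>{\<tau>..<T}. stage_cost D m \<gamma> r X))
          + (\<Sum>r\<in>{t..<\<tau>}. stage_cost D m \<gamma> r z)"
        by (simp add: AE_measure_pmf_iff)
    qed auto
    also have "\<dots> = cost D m \<tau> z \<gamma> + (\<Sum>r\<in>{t..<\<tau>}. stage_cost D m \<gamma> r z)"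
      unfolding cost_def player_law_eq stage_cost_def
      by (subst Bochner_Integration.integral_add)
        (auto intro!: player_steps_integrable z that)
    finally show ?thesis .
  qed
  have "cost D m t x \<gamma> = measure_pmf.expectation (bind_pmf ?P (\<lambda>z. player_steps D m \<gamma> \<tau> z (T - \<tau>))) ?f"
    unfolding cost_def law stage_cost_def ..
  also have "\<dots> = cost_to D m \<tau> (\<lambda>z. cost D m \<tau> z \<gamma>) t x \<gamma>"
    unfolding bind cost_to_def
    by (rule integral_cong_AE) (auto simp: AE_measure_pmf_iff tail)
  finally show ?thesis .
qed

text \<open>The integrand of \<open>cost_until\<close> sees only the path up to
  \<open>\<tau>\<close>, and stopping the player's full law at \<open>\<tau>\<close> gives the law
  after \<open>\<tau> - t\<close> steps.\<close>

lemma cost_until_eq: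
  assumes x: "x \<in> stopped_paths T t" and "t \<le> \<tau>" "\<tau> \<le> T"
    and m: "mf_law D t \<mu> \<gamma> \<in> probs (paths T)" and \<gamma>': "\<gamma>' \<in> relaxed_controls D"
  shows "cost_until D \<tau> \<psi> t \<mu> \<gamma> x \<gamma>'
    = cost_to D (mf_law D t \<mu> \<gamma>) \<tau> (\<lambda>z. \<psi> (z, stop_law T \<tau> (mf_law D t \<mu> \<gamma>))) t x \<gamma>'"
proof -
  let ?m = "mf_law D t \<mu> \<gamma>"
  have \<nu>: "return_pmf x \<in> probs (stopped_paths T t)" using x by (simp add: probs_def)
  have law: "player_steps D ?m \<gamma>' t x (\<tau> - t) = map_pmf (stop T \<tau>) (player_law D ?m t x \<gamma>')"
    using stop_path_steps[OF \<nu>, of "\<tau> - t" "T - t" "\<lambda>s P z. next_state D s z ?m (\<gamma>' s z)"] assms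
    by (simp add: player_steps_def player_law_def stop_law_def)
  show ?thesis
    unfolding cost_until_def cost_to_def law integral_map_pmf
  proof (rule integral_cong_AE)
    have "stage_cost D ?m \<gamma>' r (stop T \<tau> X) = (\<integral>a. running_cost D r X ?m a \<partial>\<gamma>' r X)"
      if "r < \<tau>" "X \<in> set_pmf (player_law D ?m t x \<gamma>')" for r X
      using stage_cost_stop[OF _ assms(3) player_steps_in(3)[OF x that(2)[unfolded player_law_eq]]
          m \<gamma>', of r] that
      by (simp add: stage_cost_def)
    then show "AE X in measure_pmf (player_law D ?m t x \<gamma>').
        \<psi> (stop T \<tau> X, stop_law T \<tau> ?m)
          + (\<Sum>s\<in>{t..<\<tau>}. \<integral>a. running_cost D s X ?m a \<partial>\<gamma>' s X)
        = \<psi> (stop T \<tau> X, stop_law T \<tau> ?m)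
          + (\<Sum>r\<in>{t..<\<tau>}. stage_cost D ?m \<gamma>' r (stop T \<tau> X))"
      by (auto simp: AE_measure_pmf_iff)
  qed auto
qed

section \<open>Bounds for the costs\<close>

lemma stage_cost_bounded:
  assumes "r \<le> T" "x \<in> paths T" "m \<in> probs (paths T)" "\<gamma> \<in> relaxed_controls D"
  shows "\<bar>stage_cost D m \<gamma> r x\<bar> \<le> C\<^sub>0"
proof -
  have \<pi>: "prob_space (\<gamma> r x)" "space (\<gamma> r x) = actions D"
    using prob_algebra_on[OF relaxed_controlsD(1)[OF assms(4,1,2)]] by auto
  interpret prob_space "\<gamma> r x" by fact
  have bound: "\<bar>running_cost D r x m a\<bar> \<le> C\<^sub>0" if "a \<in> space (\<gamma> r x)" for a
    using running_cost_bounded[OF assms(1-3)] that \<pi> by simp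
  \<comment> \<open>A probability space is nonempty, so some action exists and its bound forces
    \<open>0 \<le> C\<^sub>0\<close>. This covers the default value 0 of the integral of a
    non-integrable function.\<close>
  obtain a where "a \<in> space (\<gamma> r x)" using not_empty by blast
  then have "0 \<le> C\<^sub>0" using bound[of a] by linarith
  then show ?thesis
  proof (cases "integrable (\<gamma> r x) (running_cost D r x m)")
    case True
    then have "norm (\<integral>a. running_cost D r x m a \<partial>\<gamma> r x) \<le> (\<integral>a. C\<^sub>0 \<partial>\<gamma> r x)"
      by (rule Bochner_Integration.integral_norm_bound_integral) (simp_all add: bound)
    then show ?thesis by (simp add: stage_cost_def prob_space)
  qed (simp add: stage_cost_def not_integrable_integral_eq)
qed

lemma expectation_lower_bound:
  fixes f :: "_ \<Rightarrow> real"
  assumes "x \<in> stopped_paths T t"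
    and "\<And>X. X \<in> set_pmf (player_steps D m \<gamma> t x n) \<Longrightarrow> c \<le> f X"
  shows "c \<le> measure_pmf.expectation (player_steps D m \<gamma> t x n) f"
  using assms player_steps_integrable[OF assms(1)]
  by (intro measure_pmf.integral_ge_const) (auto simp: AE_measure_pmf_iff)

lemma sum_stage_cost_lower:
  assumes "b \<le> T" "x \<in> paths T" "m \<in> probs (paths T)" "\<gamma> \<in> relaxed_controls D"
  shows "- (real (card {a..<b}) * C\<^sub>0) \<le> (\<Sum>r\<in>{a..<b}. stage_cost D m \<gamma> r x)"
proof -
  have "(\<Sum>r\<in>{a..<b}. - C\<^sub>0) \<le> (\<Sum>r\<in>{a..<b}. stage_cost D m \<gamma> r x)"
  proof (rule sum_mono)
    fix r assume "r \<in> {a..<b}"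
    then have "\<bar>stage_cost D m \<gamma> r x\<bar> \<le> C\<^sub>0" using assms by (intro stage_cost_bounded) auto
    then show "- C\<^sub>0 \<le> stage_cost D m \<gamma> r x" by linarith
  qed
  then show ?thesis by simp
qed

text \<open>Lower boundedness is what makes a real infimum over controls lie below each cost. It
  holds for arbitrary \<open>g\<close>, which attains a minimum on the finitely many stopped
  paths.\<close>

lemma cost_to_bdd_below:
  assumes x: "x \<in> stopped_paths T t" and "t \<le> \<tau>" "\<tau> \<le> T" and m: "m \<in> probs (paths T)"
  shows "bdd_below (cost_to D m \<tau> g t x ` relaxed_controls D)"
proof (rule bdd_belowI2)
  fix \<gamma> assume \<gamma>: "\<gamma> \<in> relaxed_controls D"
  show "Min (g ` stopped_paths T \<tau>) - real (card {t..<\<tau>}) * C\<^sub>0 \<le> cost_to D m \<tau> g t x \<gamma>"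
    unfolding cost_to_def
  proof (rule expectation_lower_bound[OF x])
    fix X assume X: "X \<in> set_pmf (player_steps D m \<gamma> t x (\<tau> - t))"
    have "Min (g ` stopped_paths T \<tau>) \<le> g X"
      using player_steps_in(2)[OF x X] assms(2) by (intro Min_le) (auto simp: finite_stopped_paths)
    then show "Min (g ` stopped_paths T \<tau>) - real (card {t..<\<tau>}) * C\<^sub>0
        \<le> g X + (\<Sum>r\<in>{t..<\<tau>}. stage_cost D m \<gamma> r X)"
      using sum_stage_cost_lower[OF assms(3) player_steps_in(3)[OF x X] m \<gamma>, of t] by linarith
  qed
qed

lemma cost_eq_cost_to_horizon:
  "cost D m t x \<gamma> = cost_to D m T (\<lambda>X. terminal_cost D X m) t x \<gamma>"
  by (simp add: cost_def cost_to_def stage_cost_def player_law_eq)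

lemma cost_bdd_below:
  assumes "x \<in> stopped_paths T t" "t \<le> T" "m \<in> probs (paths T)"
  shows "bdd_below (cost D m t x ` relaxed_controls D)"
  using cost_to_bdd_below[OF assms(1,2) order_refl assms(3), of "\<lambda>X. terminal_cost D X m"]
  by (simp add: cost_eq_cost_to_horizon)

lemma opt_value_le:
  assumes "x \<in> stopped_paths T t" "t \<le> T" "m \<in> probs (paths T)" "\<gamma> \<in> relaxed_controls D"
  shows "opt_value D m t x \<le> cost D m t x \<gamma>"
  unfolding opt_value_def by (intro cINF_lower cost_bdd_below assms)

subsection \<open>The mean field flow\<close>

lemma pmf_next_state_lower:
  assumes "s \<le> T" "x \<in> paths T" "m \<in> probs (paths T)" "\<gamma> \<in> relaxed_controls D"
  shows "c\<^sub>q \<le> pmf (next_state D s x m (\<gamma> s x)) y"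
proof -
  note \<gamma> = relaxed_controlsD(1)[OF assms(4,1,2)]
  interpret prob_space "\<gamma> s x" by (rule prob_algebra_on(1)[OF \<gamma>])
  show ?thesis
    unfolding pmf_next_state[OF assms(1-3) \<gamma>]
    using transition_lower[OF assms(1-3)] prob_algebra_on(3)[OF \<gamma>]
    by (intro integral_ge_const transition_integrable assms \<gamma> AE_I2) auto
qed

text \<open>\<open>c\<^sub>q\<close> lies below a transition probability. The control guarantees
  that there is an action at all; without actions the bounds on the transitions would be
  vacuous.\<close>

lemma c\<^sub>q_le_1: "\<gamma> \<in> relaxed_controls D \<Longrightarrow> c\<^sub>q \<le> 1"
  using pmf_next_state_lower[of 0 "stop T 0 undefined" "return_pmf (stop T 0 undefined)" \<gamma> undefined]
  by (simp add: probs_def stop_in_paths order_trans[OF _ pmf_le_1])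

lemma mf_law_in:
  "t \<le> T \<Longrightarrow> \<mu> \<in> probs (stopped_paths T t) \<Longrightarrow> mf_law D t \<mu> \<gamma> \<in> probs (paths T)"
  by (simp add: mf_law_def path_steps_paths)

text \<open>Since \<open>c\<^sub>q\<close> is positive, every state has positive probability at
  every step, whatever the current law. Hence the law at \<open>\<tau>\<close> is again an
  admissible initial law and lies in the domain of the terminal functions.\<close>

lemma stop_mf_law_full:
  assumes "t \<le> \<tau>" "\<tau> \<le> T" "\<mu> \<in> full_probs (stopped_paths T t)" "\<gamma> \<in> relaxed_controls D"
  shows "stop_law T \<tau> (mf_law D t \<mu> \<gamma>) \<in> full_probs (stopped_paths T \<tau>)"
proof -
  let ?\<kappa> = "\<lambda>s P x. next_state D s x P (\<gamma> s x)"
  have \<mu>: "\<mu> \<in> probs (stopped_paths T t)" using assms(3) by (auto simp: full_probs_def probs_def)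
  have "path_steps T ?\<kappa> t \<mu> (\<tau> - t) \<in> full_probs (stopped_paths T (t + (\<tau> - t)))"
  proof (rule set_path_steps_full[OF assms(3)])
    fix s and P :: "(nat \<Rightarrow> 's) pmf" and x :: "nat \<Rightarrow> 's"
    assume *: "s < T" "P \<in> probs (paths T)" "x \<in> stopped_paths T s"
    have "0 < pmf (next_state D s x P (\<gamma> s x)) y" for y
      using pmf_next_state_lower[of s x P \<gamma> y] c\<^sub>q_pos * assms(4) stopped_paths_subset[of T s]
      by auto
    then show "set_pmf (next_state D s x P (\<gamma> s x)) = UNIV" by (auto simp: set_pmf_iff less_le)
  qed (use assms in auto)
  then show ?thesis
    using stop_path_steps[OF \<mu>, of "\<tau> - t" "T - t" ?\<kappa>] assms(1,2) by (simp add: mf_law_def)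
qed

text \<open>Up to \<open>\<tau>\<close> the flow is driven by \<open>\<gamma>\<close>; from then on
  it depends on the past only through the law reached at \<open>\<tau>\<close>, and is driven by
  \<open>\<gamma>'\<close>.\<close>

lemma mf_law_switch:
  assumes "t \<le> \<tau>" "\<tau> \<le> T" "\<mu> \<in> probs (stopped_paths T t)"
  shows "mf_law D t \<mu> (switch_control T \<tau> UNIV \<gamma> \<gamma>')
    = mf_law D \<tau> (stop_law T \<tau> (mf_law D t \<mu> \<gamma>)) \<gamma>'"
proof -
  let ?\<delta> = "switch_control T \<tau> UNIV \<gamma> \<gamma>'"
  let ?\<kappa> = "\<lambda>\<gamma> s P x. next_state D s x P (\<gamma> s x)"
  have "stop_law T \<tau> (mf_law D t \<mu> \<gamma>) = path_steps T (?\<kappa> \<gamma>) t \<mu> (\<tau> - t)"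
    using stop_path_steps[OF assms(3), of "\<tau> - t" "T - t" "?\<kappa> \<gamma>"] assms(1,2)
    by (simp add: mf_law_def)
  also have "\<dots> = path_steps T (?\<kappa> ?\<delta>) t \<mu> (\<tau> - t)"
    by (rule path_steps_cong) (auto simp: switch_control_def)
  finally have \<nu>: "stop_law T \<tau> (mf_law D t \<mu> \<gamma>) = path_steps T (?\<kappa> ?\<delta>) t \<mu> (\<tau> - t)" .
  have "mf_law D t \<mu> ?\<delta> = path_steps T (?\<kappa> ?\<delta>) \<tau> (stop_law T \<tau> (mf_law D t \<mu> \<gamma>)) (T - \<tau>)"
    using path_steps_add[of T "?\<kappa> ?\<delta>" t \<mu> "\<tau> - t" "T - \<tau>"] assms(1,2)
    unfolding \<nu> by (simp add: mf_law_def)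
  also have "\<dots> = path_steps T (?\<kappa> \<gamma>') \<tau> (stop_law T \<tau> (mf_law D t \<mu> \<gamma>)) (T - \<tau>)"
    by (rule path_steps_cong) (simp add: switch_control_def)
  finally show ?thesis by (simp add: mf_law_def)
qed

text \<open>The flow property, obtained by switching from \<open>\<gamma>\<close> to itself.\<close>

lemma mf_law_flow:
  assumes "t \<le> \<tau>" "\<tau> \<le> T" "\<mu> \<in> probs (stopped_paths T t)"
  shows "mf_law D \<tau> (stop_law T \<tau> (mf_law D t \<mu> \<gamma>)) \<gamma> = mf_law D t \<mu> \<gamma>"
proof -
  have "switch_control T \<tau> UNIV \<gamma> \<gamma> = \<gamma>" by (simp add: switch_control_def fun_eq_iff)
  then show ?thesis using mf_law_switch[OF assms, of \<gamma> \<gamma>] by simp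
qed

lemma cost_switch:
  assumes "z \<in> stopped_paths T \<tau>" "\<tau> \<le> T"
  shows "cost D m \<tau> z (switch_control T \<tau> S \<gamma> \<gamma>')
    = cost D m \<tau> z (if z \<in> S then \<gamma>' else \<gamma>)"
  using assms by (intro cost_cong) (auto simp: switch_control_def)

text \<open>Dynamic programming at \<open>\<tau>\<close>: before \<open>\<tau>\<close> only
  \<open>\<gamma>\<close> acts, and the path \<open>z\<close> reached at \<open>\<tau>\<close> alone
  decides which control is used afterwards.\<close>

lemma cost_switch_initial:
  assumes "x \<in> stopped_paths T t" "t \<le> \<tau>" "\<tau> \<le> T"
    and m: "m \<in> probs (paths T)" and \<gamma>: "\<gamma> \<in> relaxed_controls D" "\<gamma>' \<in> relaxed_controls D"
  shows "cost D m t x (switch_control T \<tau> S \<gamma> \<gamma>')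
    = cost_to D m \<tau> (\<lambda>z. cost D m \<tau> z (if z \<in> S then \<gamma>' else \<gamma>)) t x \<gamma>"
proof -
  let ?\<delta> = "switch_control T \<tau> S \<gamma> \<gamma>'"
  have "cost D m t x ?\<delta> = cost_to D m \<tau> (\<lambda>z. cost D m \<tau> z ?\<delta>) t x ?\<delta>"
    by (intro cost_dynamic_programming assms switch_control_relaxed)
  also have "\<dots> = cost_to D m \<tau> (\<lambda>z. cost D m \<tau> z ?\<delta>) t x \<gamma>"
    by (intro cost_to_cong assms switch_control_relaxed refl) (simp add: switch_control_def)
  also have "\<dots> = cost_to D m \<tau> (\<lambda>z. cost D m \<tau> z (if z \<in> S then \<gamma>' else \<gamma>)) t x \<gamma>"
    by (intro antisym cost_to_mono[where c = 0, simplified] assms) (simp_all add: cost_switch assms)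
  finally show ?thesis .
qed

subsection \<open>Equilibria on a shorter horizon\<close>

text \<open>A player who is suboptimal by \<open>g\<close> at \<open>(\<tau>, z)\<close> gains at least \<open>g\<close> times the probability of
  reaching \<open>z\<close>, which is at least \<open>c\<^sub>q\<^bsup>\<tau>-t\<^esup>\<close>, by deviating only after \<open>z\<close>.\<close>

lemma later_near_optimal:
  assumes "t \<le> \<tau>" "\<tau> \<le> T" and m: "m \<in> probs (paths T)" and \<gamma>: "\<gamma> \<in> relaxed_controls D"
    and opt: "\<And>x. x \<in> stopped_paths T t \<Longrightarrow> cost D m t x \<gamma> \<le> opt_value D m t x + c\<^sub>q ^ (\<tau> - t) * \<epsilon>"
    and z: "z \<in> stopped_paths T \<tau>" and "0 < \<epsilon>"
  shows "cost D m \<tau> z \<gamma> \<le> opt_value D m \<tau> z + \<epsilon>"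
proof -
  have le: "cost D m \<tau> z \<gamma> - \<epsilon> \<le> cost D m \<tau> z \<gamma>'" if \<gamma>': "\<gamma>' \<in> relaxed_controls D" for \<gamma>'
  proof (rule ccontr)
    assume "\<not> ?thesis"
    then have gap: "\<epsilon> < cost D m \<tau> z \<gamma> - cost D m \<tau> z \<gamma>'" by simp
    define g where "g = cost D m \<tau> z \<gamma> - cost D m \<tau> z \<gamma>'"
    \<comment> \<open>The only initial path from which \<open>z\<close> can be reached. A player
      starting there will gain too much by switching to \<open>\<gamma>'\<close> after
      \<open>z\<close>.\<close>
    define x where "x = stop T t z"
    have x: "x \<in> stopped_paths T t" by (simp add: x_def stopped_paths_iff stop_stop)
    let ?P = "player_steps D m \<gamma> t x (\<tau> - t)"
    let ?J = "\<lambda>w. cost D m \<tau> w (if w \<in> {z} then \<gamma>' else \<gamma>)"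
    have "c\<^sub>q ^ (\<tau> - t) \<le> pmf ?P z"
      unfolding player_steps_def
    proof (rule pmf_path_steps_lower[OF x])
      fix s and w :: "nat \<Rightarrow> 's" and y assume "s < T" "w \<in> stopped_paths T s"
      then show "c\<^sub>q \<le> pmf (next_state D s w m (\<gamma> s w)) y"
        using stopped_paths_subset[of T s] m \<gamma> by (intro pmf_next_state_lower) auto
    qed (use assms c\<^sub>q_pos in \<open>auto simp: x_def\<close>)
    then have "c\<^sub>q ^ (\<tau> - t) * \<epsilon> < pmf ?P z * g"
      using gap c\<^sub>q_pos \<open>0 < \<epsilon>\<close> by (intro mult_le_less_imp_less) (auto simp: g_def)
    \<comment> \<open>The costs from \<open>\<tau>\<close> differ only at \<open>w = z\<close>, so
      the difference of the expectations is the gap there, weighted by the mass of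
      \<open>z\<close>.\<close>
    moreover have "cost D m t x (switch_control T \<tau> {z} \<gamma> \<gamma>') = cost D m t x \<gamma> - pmf ?P z * g"
    proof -
      have "cost D m t x \<gamma> - cost D m t x (switch_control T \<tau> {z} \<gamma> \<gamma>')
          = cost_to D m \<tau> (\<lambda>w. cost D m \<tau> w \<gamma>) t x \<gamma> - cost_to D m \<tau> ?J t x \<gamma>"
        using cost_dynamic_programming[OF x assms(1,2) m \<gamma>]
          cost_switch_initial[OF x assms(1,2) m \<gamma> \<gamma>', of "{z}"] by simp
      also have "\<dots> = measure_pmf.expectation ?P
          (\<lambda>w. (cost D m \<tau> w \<gamma> + (\<Sum>r\<in>{t..<\<tau>}. stage_cost D m \<gamma> r w))
            - (?J w + (\<Sum>r\<in>{t..<\<tau>}. stage_cost D m \<gamma> r w)))"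
        unfolding cost_to_def
        by (rule Bochner_Integration.integral_diff[symmetric]; intro player_steps_integrable x)
      also have "\<dots> = measure_pmf.expectation ?P (\<lambda>w. indicator {z} w * g)"
        by (rule Bochner_Integration.integral_cong) (auto simp: g_def)
      also have "\<dots> = pmf ?P z * g" by (simp add: measure_pmf_single)
      finally show ?thesis by simp
    qed
    moreover have "cost D m t x \<gamma> \<le> cost D m t x (switch_control T \<tau> {z} \<gamma> \<gamma>') + c\<^sub>q ^ (\<tau> - t) * \<epsilon>"
      using opt[OF x] opt_value_le[OF x _ m switch_control_relaxed[OF \<gamma> \<gamma>'], of \<tau> "{z}"] assms
      by linarith
    ultimately show False by linarith
  qed
  have "cost D m \<tau> z \<gamma> - \<epsilon> \<le> opt_value D m \<tau> z"
    unfolding opt_value_def using \<gamma> le by (intro cINF_greatest) auto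
  then show ?thesis by simp
qed

section \<open>The two inclusions with explicit errors\<close>

lemma V_relax_imp_until:
  assumes "t \<le> \<tau>" "\<tau> \<le> T" and \<mu>: "\<mu> \<in> full_probs (stopped_paths T t)" and "0 < \<epsilon>"
    and \<phi>: "\<phi> \<in> V_relax D t \<mu>"
  shows "\<exists>\<psi> \<in> L0 (count_space (stopped_paths T \<tau>) \<Otimes>\<^sub>M full_probs_space (stopped_paths T \<tau>)).
    \<exists>\<gamma> \<in> relaxed_controls D.
      sup_norm (stopped_paths T t) (\<lambda>x. \<phi> x - cost_until D \<tau> \<psi> t \<mu> \<gamma> x \<gamma>) \<le> \<epsilon> \<and>
      (\<lambda>x. \<psi> (x, stop_law T \<tau> (mf_law D t \<mu> \<gamma>)))
        \<in> V_relax_eps D \<epsilon> \<tau> (stop_law T \<tau> (mf_law D t \<mu> \<gamma>)) \<and>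
      \<gamma> \<in> relaxed_equilibria_until D \<epsilon> \<tau> \<psi> t \<mu>"
proof -
  \<comment> \<open>The tolerance is scaled down so that the loss in
    \<open>later_near_optimal\<close> leaves exactly \<open>\<epsilon>\<close> at time
    \<open>\<tau>\<close>.\<close>
  define \<delta> where "\<delta> = c\<^sub>q ^ (\<tau> - t) * \<epsilon>"
  have "0 < \<delta>" using c\<^sub>q_pos assms by (simp add: \<delta>_def)
  then obtain \<gamma> where eq: "\<gamma> \<in> relaxed_equilibria D \<delta> t \<mu>"
      and near: "sup_norm (stopped_paths T t) (\<lambda>x. \<phi> x - cost D (mf_law D t \<mu> \<gamma>) t x \<gamma>) \<le> \<delta>"
    using \<phi> by (auto simp: V_relax_def V_relax_eps_def)
  define m where "m = mf_law D t \<mu> \<gamma>"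
  define \<nu> where "\<nu> = stop_law T \<tau> m"
  have \<gamma>: "\<gamma> \<in> relaxed_controls D"
    and opt: "\<And>x. x \<in> stopped_paths T t \<Longrightarrow> cost D m t x \<gamma> \<le> opt_value D m t x + \<delta>"
    using eq by (auto simp: relaxed_equilibria_def m_def)
  have "\<delta> \<le> \<epsilon>"
    using c\<^sub>q_le_1[OF \<gamma>] c\<^sub>q_pos assms
    by (simp add: \<delta>_def mult_left_le_one_le power_le_one)
  have \<mu>': "\<mu> \<in> probs (stopped_paths T t)" using \<mu> by (auto simp: full_probs_def probs_def)
  have m: "m \<in> probs (paths T)" using assms \<mu>' by (simp add: m_def mf_law_in)
  have \<nu>: "\<nu> \<in> full_probs (stopped_paths T \<tau>)"
    using stop_mf_law_full[OF assms(1,2) \<mu> \<gamma>] by (simp add: \<nu>_def m_def)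
  \<comment> \<open>Seen from \<open>\<tau>\<close>, the control \<open>\<gamma>\<close> generates
    the same environment, so its optimality from \<open>t\<close> and from \<open>\<tau>\<close> can
    be compared.\<close>
  have flow: "mf_law D \<tau> \<nu> \<gamma> = m"
    using mf_law_flow[OF assms(1,2) \<mu>'] by (simp add: \<nu>_def m_def)
  let ?M = "count_space (stopped_paths T \<tau>) \<Otimes>\<^sub>M full_probs_space (stopped_paths T \<tau>)"
  \<comment> \<open>The terminal function may be constant in the measure, because the environment of
    the short game is held at \<open>m\<close> and only the value at \<open>\<nu>\<close> enters.
    Measurability then reduces to a discrete space, and the restriction supplies
    extensionality.\<close>
  define \<psi> :: "(nat \<Rightarrow> 's) \<times> (nat \<Rightarrow> 's) pmf \<Rightarrow> real" where "\<psi> = restrict (\<lambda>p. cost D m \<tau> (fst p) \<gamma>) (space ?M)"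
  have \<psi>: "\<psi> (z, \<nu>) = cost D m \<tau> z \<gamma>" if "z \<in> stopped_paths T \<tau>" for z
    using that \<nu> by (simp add: \<psi>_def space_pair_measure space_full_probs_space)
  have "(\<lambda>p. cost D m \<tau> (fst p) \<gamma>) \<in> borel_measurable ?M"
    by (rule measurable_compose[OF measurable_fst]) simp
  then have "\<psi> \<in> L0 ?M"
    unfolding L0_def \<psi>_def by (auto simp: cong: measurable_cong_simp)
  \<comment> \<open>A deviation \<open>\<gamma>'\<close> in the short game costs the same as the
    full-horizon deviation that plays \<open>\<gamma>'\<close> before \<open>\<tau>\<close> and then
    returns to \<open>\<gamma>\<close>. Near optimality on the full horizon therefore covers
    it.\<close>
  moreover have until: "cost_until D \<tau> \<psi> t \<mu> \<gamma> x \<gamma>'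
      = cost D m t x (switch_control T \<tau> UNIV \<gamma>' \<gamma>)"
    if x: "x \<in> stopped_paths T t" and \<gamma>': "\<gamma>' \<in> relaxed_controls D" for x \<gamma>'
  proof -
    have "cost_until D \<tau> \<psi> t \<mu> \<gamma> x \<gamma>' = cost_to D m \<tau> (\<lambda>z. \<psi> (z, \<nu>)) t x \<gamma>'"
      using cost_until_eq[OF x assms(1,2) _ \<gamma>', of \<mu> \<gamma> \<psi>] m by (simp add: m_def \<nu>_def)
    also have "\<dots> = cost_to D m \<tau> (\<lambda>z. cost D m \<tau> z \<gamma>) t x \<gamma>'"
      by (intro antisym cost_to_mono[where c = 0, simplified] assms x) (simp_all add: \<psi>)
    also have "\<dots> = cost D m t x (switch_control T \<tau> UNIV \<gamma>' \<gamma>)"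
      using cost_switch_initial[OF x assms(1,2) m \<gamma>' \<gamma>, of UNIV] by simp
    finally show ?thesis .
  qed
  have "switch_control T \<tau> UNIV \<gamma> \<gamma> = \<gamma>" by (simp add: switch_control_def fun_eq_iff)
  then have self: "cost_until D \<tau> \<psi> t \<mu> \<gamma> x \<gamma> = cost D m t x \<gamma>" if "x \<in> stopped_paths T t" for x
    using until[OF that \<gamma>] by simp
  have "sup_norm (stopped_paths T t) (\<lambda>x. \<phi> x - cost_until D \<tau> \<psi> t \<mu> \<gamma> x \<gamma>) \<le> \<epsilon>"
    using near \<open>\<delta> \<le> \<epsilon>\<close>
    by (fastforce simp: sup_norm_le_iff finite_stopped_paths stopped_paths_nonempty self m_def[symmetric])
  \<comment> \<open>The control \<open>\<gamma>\<close> itself is the witness: on the stopped paths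
    its cost from \<open>\<tau>\<close> is exactly \<open>\<psi>\<close> at
    \<open>\<nu>\<close>.\<close>
  moreover have "(\<lambda>x. \<psi> (x, \<nu>)) \<in> V_relax_eps D \<epsilon> \<tau> \<nu>"
  proof -
    have "(\<lambda>x. \<psi> (x, \<nu>)) \<in> L0 (count_space (stopped_paths T \<tau>))"
      by (auto simp: L0_def \<psi>_def extensional_def space_pair_measure)
    moreover have "\<gamma> \<in> relaxed_equilibria D \<epsilon> \<tau> \<nu>"
      using later_near_optimal[OF assms(1,2) m \<gamma>] opt \<gamma> \<open>0 < \<epsilon>\<close>
      by (auto simp: relaxed_equilibria_def flow \<delta>_def)
    moreover have "sup_norm (stopped_paths T \<tau>) (\<lambda>x. \<psi> (x, \<nu>) - cost D (mf_law D \<tau> \<nu> \<gamma>) \<tau> x \<gamma>) \<le> \<epsilon>"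
      using \<open>0 < \<epsilon>\<close>
      by (simp add: sup_norm_le_iff finite_stopped_paths stopped_paths_nonempty flow \<psi>)
    ultimately show ?thesis by (auto simp: V_relax_eps_def)
  qed
  moreover have "\<gamma> \<in> relaxed_equilibria_until D \<epsilon> \<tau> \<psi> t \<mu>"
  proof -
    have "cost_until D \<tau> \<psi> t \<mu> \<gamma> x \<gamma>
        \<le> (INF \<gamma>'\<in>relaxed_controls D. cost_until D \<tau> \<psi> t \<mu> \<gamma> x \<gamma>') + \<epsilon>"
      if x: "x \<in> stopped_paths T t" for x
    proof -
      have "cost D m t x \<gamma> - \<epsilon> \<le> (INF \<gamma>'\<in>relaxed_controls D. cost_until D \<tau> \<psi> t \<mu> \<gamma> x \<gamma>')"
      proof (rule cINF_greatest)
        fix \<gamma>' assume \<gamma>': "\<gamma>' \<in> relaxed_controls D"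
        show "cost D m t x \<gamma> - \<epsilon> \<le> cost_until D \<tau> \<psi> t \<mu> \<gamma> x \<gamma>'"
          using opt[OF x] opt_value_le[OF x _ m switch_control_relaxed[OF \<gamma>' \<gamma>], of \<tau> UNIV]
            until[OF x \<gamma>'] \<open>\<delta> \<le> \<epsilon>\<close> assms by linarith
      qed (use \<gamma> in auto)
      then show ?thesis by (simp add: self[OF x])
    qed
    then show ?thesis using \<gamma> by (simp add: relaxed_equilibria_until_def)
  qed
  ultimately show ?thesis using \<gamma> unfolding \<nu>_def m_def by blast
qed

text \<open>The factor 4 collects one \<open>\<epsilon>\<close> each for passing from the
  concatenated control to the short game, for near optimality there, for replacing
  \<open>\<psi>\<close> by the cost of \<open>\<gamma>'\<close>, and for near optimality of
  \<open>\<gamma>'\<close> from \<open>\<tau>\<close>. The distance to \<open>\<phi>\<close> uses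
  only two of them.\<close>

lemma until_imp_V_relax_eps:
  assumes "t \<le> \<tau>" "\<tau> \<le> T" and \<mu>: "\<mu> \<in> probs (stopped_paths T t)" and "0 < \<epsilon>"
    and \<phi>: "\<phi> \<in> L0 (count_space (stopped_paths T t))" and \<gamma>: "\<gamma> \<in> relaxed_controls D"
    and near: "sup_norm (stopped_paths T t) (\<lambda>x. \<phi> x - cost_until D \<tau> \<psi> t \<mu> \<gamma> x \<gamma>) \<le> \<epsilon>"
    and V: "(\<lambda>x. \<psi> (x, stop_law T \<tau> (mf_law D t \<mu> \<gamma>)))
        \<in> V_relax_eps D \<epsilon> \<tau> (stop_law T \<tau> (mf_law D t \<mu> \<gamma>))"
    and eq: "\<gamma> \<in> relaxed_equilibria_until D \<epsilon> \<tau> \<psi> t \<mu>"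
  shows "\<phi> \<in> V_relax_eps D (4 * \<epsilon>) t \<mu>"
proof -
  define m where "m = mf_law D t \<mu> \<gamma>"
  define \<nu> where "\<nu> = stop_law T \<tau> m"
  obtain \<gamma>' where "\<gamma>' \<in> relaxed_equilibria D \<epsilon> \<tau> \<nu>"
      and near': "sup_norm (stopped_paths T \<tau>) (\<lambda>x. \<psi> (x, \<nu>) - cost D (mf_law D \<tau> \<nu> \<gamma>') \<tau> x \<gamma>') \<le> \<epsilon>"
    using V by (auto simp: V_relax_eps_def \<nu>_def m_def)
  define m' where "m' = mf_law D \<tau> \<nu> \<gamma>'"
  define \<delta> where "\<delta> = switch_control T \<tau> UNIV \<gamma> \<gamma>'"
  have \<gamma>': "\<gamma>' \<in> relaxed_controls D"
    and opt: "\<And>z. z \<in> stopped_paths T \<tau> \<Longrightarrow> cost D m' \<tau> z \<gamma>' \<le> opt_value D m' \<tau> z + \<epsilon>"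
    using \<open>\<gamma>' \<in> relaxed_equilibria D \<epsilon> \<tau> \<nu>\<close> by (auto simp: relaxed_equilibria_def m'_def)
  have \<delta>: "\<delta> \<in> relaxed_controls D" unfolding \<delta>_def by (intro switch_control_relaxed \<gamma> \<gamma>')
  \<comment> \<open>The concatenated control generates precisely the environment in which
    \<open>\<gamma>'\<close> is nearly optimal from \<open>\<tau>\<close> on.\<close>
  have law: "mf_law D t \<mu> \<delta> = m'"
    unfolding \<delta>_def m'_def \<nu>_def m_def by (intro mf_law_switch assms)
  have m: "m \<in> probs (paths T)" using assms by (simp add: m_def mf_law_in)
  have "\<nu> \<in> probs (stopped_paths T \<tau>)"
    by (auto simp: \<nu>_def stop_law_def probs_def stopped_paths_iff stop_stop)
  \<comment> \<open>Both environments have law \<open>\<nu>\<close> at \<open>\<tau>\<close>, since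
    \<open>m'\<close> starts from it. By adaptedness the short game, defined through
    \<open>m\<close>, can then be evaluated in \<open>m'\<close>.\<close>
  then have m': "m' \<in> probs (paths T)" and \<nu>: "stop_law T \<tau> m = stop_law T \<tau> m'"
    using assms(2) mf_law_initial[of \<tau> \<nu> \<gamma>'] by (simp_all add: m'_def mf_law_in \<nu>_def)
  have \<psi>: "\<bar>\<psi> (z, \<nu>) - cost D m' \<tau> z \<gamma>'\<bar> \<le> \<epsilon>" if "z \<in> stopped_paths T \<tau>" for z
    using near' that
    by (auto simp: sup_norm_le_iff finite_stopped_paths stopped_paths_nonempty m'_def)
  have until: "cost_until D \<tau> \<psi> t \<mu> \<gamma> x \<beta> = cost_to D m' \<tau> (\<lambda>z. \<psi> (z, \<nu>)) t x \<beta>"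
    if x: "x \<in> stopped_paths T t" and \<beta>: "\<beta> \<in> relaxed_controls D" for x \<beta>
  proof -
    have "cost_until D \<tau> \<psi> t \<mu> \<gamma> x \<beta> = cost_to D m \<tau> (\<lambda>z. \<psi> (z, \<nu>)) t x \<beta>"
      using cost_until_eq[OF x assms(1,2) _ \<beta>, of \<mu> \<gamma> \<psi>] m by (simp add: m_def \<nu>_def)
    also have "\<dots> = cost_to D m' \<tau> (\<lambda>z. \<psi> (z, \<nu>)) t x \<beta>"
      by (intro cost_to_cong x assms m m' \<nu> \<beta> refl)
    finally show ?thesis .
  qed
  have cost_\<delta>: "cost D m' t x \<delta> = cost_to D m' \<tau> (\<lambda>z. cost D m' \<tau> z \<gamma>') t x \<gamma>"
    if x: "x \<in> stopped_paths T t" for x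
    using cost_switch_initial[OF x assms(1,2) m' \<gamma> \<gamma>', of UNIV] by (simp add: \<delta>_def)
  have close: "\<bar>cost_until D \<tau> \<psi> t \<mu> \<gamma> x \<gamma> - cost D m' t x \<delta>\<bar> \<le> \<epsilon>"
    if x: "x \<in> stopped_paths T t" for x
  proof -
    have "cost_to D m' \<tau> (\<lambda>z. \<psi> (z, \<nu>)) t x \<gamma> \<le> cost_to D m' \<tau> (\<lambda>z. cost D m' \<tau> z \<gamma>') t x \<gamma> + \<epsilon>"
      using \<psi> by (intro cost_to_mono x assms(1)) (fastforce simp: abs_le_iff)
    moreover have "cost_to D m' \<tau> (\<lambda>z. cost D m' \<tau> z \<gamma>') t x \<gamma> \<le> cost_to D m' \<tau> (\<lambda>z. \<psi> (z, \<nu>)) t x \<gamma> + \<epsilon>"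
      using \<psi> by (intro cost_to_mono x assms(1)) (fastforce simp: abs_le_iff)
    ultimately show ?thesis by (simp add: until[OF x \<gamma>] cost_\<delta>[OF x] abs_le_iff)
  qed
  have best: "cost D m' t x \<delta> \<le> cost D m' t x \<beta> + 4 * \<epsilon>"
    if x: "x \<in> stopped_paths T t" and \<beta>: "\<beta> \<in> relaxed_controls D" for x \<beta>
  proof -
    have "bdd_below (cost_until D \<tau> \<psi> t \<mu> \<gamma> x ` relaxed_controls D)"
      using cost_to_bdd_below[OF x assms(1,2) m', of "\<lambda>z. \<psi> (z, \<nu>)"] until[OF x]
      by (simp cong: image_cong_simp)
    then have "(INF \<beta>\<in>relaxed_controls D. cost_until D \<tau> \<psi> t \<mu> \<gamma> x \<beta>) \<le> cost_until D \<tau> \<psi> t \<mu> \<gamma> x \<beta>"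
      using \<beta> by (rule cINF_lower)
    then have "cost_until D \<tau> \<psi> t \<mu> \<gamma> x \<gamma> \<le> cost_until D \<tau> \<psi> t \<mu> \<gamma> x \<beta> + \<epsilon>"
      using eq x by (fastforce simp: relaxed_equilibria_until_def)
    \<comment> \<open>At \<open>\<tau>\<close> the function \<open>\<psi>\<close> exceeds the cost
      of \<open>\<gamma>'\<close> by at most \<open>\<epsilon>\<close>, and that cost exceeds the
      cost of \<open>\<beta>\<close> by at most another \<open>\<epsilon>\<close>; dynamic
      programming carries both errors back to \<open>t\<close>.\<close>
    moreover have "cost_until D \<tau> \<psi> t \<mu> \<gamma> x \<beta> \<le> cost D m' t x \<beta> + 2 * \<epsilon>"
      unfolding until[OF x \<beta>] cost_dynamic_programming[OF x assms(1,2) m' \<beta>]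
    proof (intro cost_to_mono x assms(1))
      fix z :: "nat \<Rightarrow> 's" assume z: "z \<in> stopped_paths T \<tau>"
      show "\<psi> (z, \<nu>) \<le> cost D m' \<tau> z \<beta> + 2 * \<epsilon>"
        using \<psi>[OF z] opt[OF z] opt_value_le[OF z assms(2) m' \<beta>] by (simp add: abs_le_iff)
    qed
    ultimately show ?thesis using close[OF x] by (simp add: abs_le_iff)
  qed
  have "cost D m' t x \<delta> \<le> opt_value D m' t x + 4 * \<epsilon>" if x: "x \<in> stopped_paths T t" for x
  proof -
    have "cost D m' t x \<delta> - 4 * \<epsilon> \<le> opt_value D m' t x"
      unfolding opt_value_def using \<gamma> best[OF x] by (intro cINF_greatest) (auto simp: diff_le_eq)
    then show ?thesis by simp
  qed
  then have "\<delta> \<in> relaxed_equilibria D (4 * \<epsilon>) t \<mu>"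
    using \<delta> by (simp add: relaxed_equilibria_def law)
  moreover have "sup_norm (stopped_paths T t) (\<lambda>x. \<phi> x - cost D (mf_law D t \<mu> \<delta>) t x \<delta>) \<le> 4 * \<epsilon>"
  proof -
    have "\<bar>\<phi> x - cost D m' t x \<delta>\<bar> \<le> 4 * \<epsilon>" if x: "x \<in> stopped_paths T t" for x
    proof -
      have "\<bar>\<phi> x - cost_until D \<tau> \<psi> t \<mu> \<gamma> x \<gamma>\<bar> \<le> \<epsilon>"
        using near x by (simp add: sup_norm_le_iff finite_stopped_paths stopped_paths_nonempty)
      then show ?thesis using close[OF x] \<open>0 < \<epsilon>\<close> by linarith
    qed
    then show ?thesis
      by (simp add: sup_norm_le_iff finite_stopped_paths stopped_paths_nonempty law)
  qed
  ultimately show ?thesis using \<phi> by (auto simp: V_relax_eps_def)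
qed

end

section \<open>Passage to the intersection over all errors\<close>

theorem theorem4p2:
  fixes D :: "('s::finite, 'a::euclidean_space) mfg"
    and c\<^sub>q L\<^sub>q C\<^sub>0 :: real and \<rho> :: "real \<Rightarrow> real"
    and t T\<^sub>0 :: nat and \<mu> :: "(nat \<Rightarrow> 's) pmf"
  assumes "mean_field_game D c\<^sub>q L\<^sub>q C\<^sub>0 \<rho>"
    and "t \<in> {0..horizon D}" and "T\<^sub>0 \<in> {t..horizon D}"
    and "\<mu> \<in> full_probs (stopped_paths (horizon D) t)"
  shows "V_relax D t \<mu> =
    (\<Inter>\<epsilon>\<in>{0<..}. {\<phi> \<in> L0 (count_space (stopped_paths (horizon D) t)).
      \<exists>\<psi> \<in> L0 (count_space (stopped_paths (horizon D) T\<^sub>0)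
                 \<Otimes>\<^sub>M full_probs_space (stopped_paths (horizon D) T\<^sub>0)).
      \<exists>\<gamma> \<in> relaxed_controls D.
        sup_norm (stopped_paths (horizon D) t)
          (\<lambda>x. \<phi> x - cost_until D T\<^sub>0 \<psi> t \<mu> \<gamma> x \<gamma>) \<le> \<epsilon> \<and>
        (\<lambda>x. \<psi> (x, stop_law (horizon D) T\<^sub>0 (mf_law D t \<mu> \<gamma>)))
          \<in> V_relax_eps D \<epsilon> T\<^sub>0 (stop_law (horizon D) T\<^sub>0 (mf_law D t \<mu> \<gamma>)) \<and>
        \<gamma> \<in> relaxed_equilibria_until D \<epsilon> T\<^sub>0 \<psi> t \<mu>})"
    (is "_ = (\<Inter>\<epsilon>\<in>{0<..}. ?R \<epsilon>)")
proof -
  interpret mean_field_game D c\<^sub>q L\<^sub>q C\<^sub>0 \<rho> by fact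
  have T\<^sub>0: "t \<le> T\<^sub>0" "T\<^sub>0 \<le> horizon D" using assms(3) by auto
  have \<mu>: "\<mu> \<in> probs (stopped_paths (horizon D) t)"
    using assms(4) by (auto simp: full_probs_def probs_def)
  show ?thesis
  proof (intro subset_antisym subsetI INT_I)
    fix \<phi> and \<epsilon> :: real assume \<phi>: "\<phi> \<in> V_relax D t \<mu>" and \<epsilon>: "\<epsilon> \<in> {0<..}"
    \<comment> \<open>Any positive error would do here in place of 1, as measurability is part of
      each set in the intersection.\<close>
    have "\<phi> \<in> L0 (count_space (stopped_paths (horizon D) t))"
      using INT_D[OF \<phi>[unfolded V_relax_def], of 1] by (simp add: V_relax_eps_def)
    then show "\<phi> \<in> ?R \<epsilon>"
      using V_relax_imp_until[OF T\<^sub>0 assms(4) _ \<phi>, of \<epsilon>] \<epsilon> by simp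
  next
    fix \<phi> assume \<phi>: "\<phi> \<in> (\<Inter>\<epsilon>\<in>{0<..}. ?R \<epsilon>)"
    show "\<phi> \<in> V_relax D t \<mu>"
      unfolding V_relax_def
    proof (rule INT_I)
      fix \<epsilon> :: real assume "\<epsilon> \<in> {0<..}"
      \<comment> \<open>Dividing by 4 compensates for the accumulated error of
        \<open>until_imp_V_relax_eps\<close>.\<close>
      then have \<epsilon>: "0 < \<epsilon> / 4" by simp
      then have "\<phi> \<in> ?R (\<epsilon> / 4)" using \<phi> by blast
      then show "\<phi> \<in> V_relax_eps D \<epsilon> t \<mu>"
        using until_imp_V_relax_eps[OF T\<^sub>0 \<mu> \<epsilon>] by auto
    qed
  qed
qed

end
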